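(* Let $\mathbf{P}_n\in\mathbb{R}^{n\times n}$ be the Jacobi matrix constructed from the quadrature data $(\theta_j,y_j)_{j=1}^n$ by the Lanczos algorithm described in the context, let $\mathbf{b}_n=\sqrt{c}\,\mathbf{e}_1\in\mathbb{R}^n$, and let $V=[\vartheta_1(x),\ldots,\vartheta_n(x)]$ be the row of normalized orthogonalized snapshots. Then $\mathbf{P}_n$ and $\mathbf{b}_n$ are (up to scaling for $\mathbf{b}_n$) the orthogonal projections of $P$ and $b$, respectively, onto the Krylov subspace $$\mathcal{K}_n(u_0,P)=\mathrm{span}\{u_0,\ldots,u_{n-1}\}=\mathrm{span}\{\overline{u}_1,\ldots,\overline{u}_n\},$$ i.e. $$\mathbf{P}_n=V^*PV\qquad\text{and}\qquad \mathbf{b}_n=\frac{1}{\sqrt{c}}\,V^*b .$$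
   Context: Setting. Let $x_{\max}>0$ and let $v$ be a sufficiently regular positive function on $[0,x_{\max}]$. Let $A=-v^2\frac{d^2}{dx^2}$ with boundary conditions $u_x|_{x=0}=0$, $u|_{x=x_{\max}}=0$; it is self-adjoint and positive definite for $\langle\langle u,w\rangle\rangle=\int_0^{x_{\max}}u(x)w(x)\frac{1}{v^2(x)}\,dx$. Let $\delta(x+0)$ be the right-half Dirac delta ($\int_0^\infty\delta(x+0)\,dx=1$, so $\langle\langle\delta(x+0),h\rangle\rangle=h(0)/v(0)^2$). Let $q\in L_1(\mathbb{R})$ be an even, sufficiently smooth approximation of $\delta(t)$ with nonnegative Fourier transform $\widetilde q(s^2)=\int_0^\infty 2\cos(ts)q(t)\,dt$ and with $\widetilde q(A)$ positive definite (e.g. $\widetilde q(s^2)=e^{-\sigma^2s^2/2}$, $\sigma>0$). Put $b=v(0)\,\widetilde q(A)^{1/2}\delta(x+0)$. Fix $\tau>0$ and $n\in\mathbb{N}$, and let $P=\cos(\tau\sqrt A)$, $u_k=\cos(k\tau\sqrt A)b=T_k(P)b$ ($T_k$: Chebyshev polynomials of the first kind), so $u_0=b$, and $f_k=\langle\langle u_0,u_k\rangle\rangle$ for $k=0,\ldots,2n-1$, $c=f_0$. The vector $\mathbf{e}_1\in\mathbb{R}^n$ is the first standard basis vector. For rows of functions $W=[w_1,\ldots,w_n]$, $G=[g_1,\ldots,g_n]$, $W^*G$ denotes the matrix with entries $\langle\langle w_i,g_j\rangle\rangle$; likewise $V^*PV$ has entries $\langle\langle\vartheta_i,P\vartheta_j\rangle\rangle$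 and $V^*b$ is the vector with entries $\langle\langle\vartheta_i,b\rangle\rangle$. $\mathcal{K}_n(u_0,P)=\mathrm{span}\{u_0,Pu_0,\ldots,P^{n-1}u_0\}$. Standing assumption. Let $(\lambda_l,z_l)_{l\ge1}$ be the eigenpairs of $A$, with $\langle\langle z_l,z_k\rangle\rangle=\delta_{lk}$ (Kronecker delta), and let $\eta_0(\mu)\,d\mu$ be the measure on $[-1,1]$ obtained as the push-forward of the measure $\sum_l\widetilde q(\lambda_l)\frac{z_l(0)^2}{v(0)^2}\,\delta(\lambda-\lambda_l)\,d\lambda$ under $\lambda\mapsto\cos(\tau\sqrt\lambda)$, so that $f_k=\int_{-1}^1T_k(\mu)\eta_0(\mu)\,d\mu$. It is assumed that $c^{-1}\eta_0(\mu)\,d\mu$ is a probability measure such that $s\mapsto\int_{-1}^sc^{-1}\eta_0(\mu)\,d\mu$ has at least $n$ points of increase on $[-1,1]$. Quadrature data. $(\theta_j,y_j)_{j=1}^n$ is the (classically unique) solution, with $y_j>0$ and pairwise distinct $\theta_j\in(-1,1)$, of $\sum_{j=1}^ny_j^2T_k(\theta_j)=f_k$, $k=0,\ldots,2n-1$. Construction of $\mathbf{P}_n$. $\mathbf{P}_n$ is the symmetric tridiagonal matrix with diagonal entries $\alpha_1,\ldots,\alpha_n$ and off-diagonal entries $\beta_1,\ldots,\beta_{n-1}$ produced as follows, with $\langle p,g\rangle_{y,\theta}=\frac1c\sum_{j=1}^ny_j^2p(\theta_j)g(\theta_j)$: set $q_0\equiv0$, $q_1\equiv1$; for $j=1,\ldots,n$: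 $\alpha_j=\langle q_j,xq_j\rangle_{y,\theta}$; $r=(x-\alpha_j)q_j-\beta_{j-1}q_{j-1}$; $\beta_j=\sqrt{\langle r,r\rangle_{y,\theta}}$; $q_{j+1}=r/\beta_j$ (only $\alpha_1,\ldots,\alpha_n$ and $\beta_1,\ldots,\beta_{n-1}$ are used). Orthogonalized snapshots. Let $\widetilde x(x)=\int_0^x\frac{dx'}{v(x')}$, $\widetilde x_{\max}=\widetilde x(x_{\max})$, $\widetilde v(\widetilde x)=v(x(\widetilde x))$, $\widetilde b(\widetilde x)=b(x(\widetilde x))$, $\langle f,g\rangle_{1/\widetilde v}=\int_0^{\widetilde x_{\max}}fg\frac1{\widetilde v}\,d\widetilde x$ and $\langle f,g\rangle_{\widetilde v}=\int_0^{\widetilde x_{\max}}fg\,\widetilde v\,d\widetilde x$, with norms $\|\cdot\|_{1/\widetilde v}$, $\|\cdot\|_{\widetilde v}$; $\widetilde Af=-\widetilde v\,\partial_{\widetilde x}(\frac1{\widetilde v}\partial_{\widetilde x}f)$ with $f_{\widetilde x}(0)=0$, $f(\widetilde x_{\max})=0$ (this is $A$ in the coordinate $\widetilde x$), $\widetilde P=\cos(\tau\sqrt{\widetilde A})$ and $\xi(x)=-\frac{2}{\tau^2}(1-x)$. Let $L_\tau=\frac2\tau\partial_{\widetilde x}\widetilde A^{-1/2}\sin(\tfrac\tau2\sqrt{\widetilde A})$ and let $L_\tau^T=-\frac2\tau\frac1{\widetilde v}\sin(\tfrac\tau2\sqrt{\widetilde A})\widetilde A^{-1/2}\,\widetilde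 v\,\partial_{\widetilde x}$ be its $L^2[0,\widetilde x_{\max}]$-adjoint. The orthogonalized snapshots $\overline u_j$ are generated by: $\overline w_0=0$, $\overline u_1=\widetilde b$; for $j=1,\ldots,n$: $\widehat\gamma_j=\|\overline u_j\|_{1/\widetilde v}^{-2}$; $\overline w_j=\overline w_{j-1}+\widehat\gamma_j\frac1{\widetilde v}L_\tau\overline u_j$; $\gamma_j=\|\overline w_j\|_{\widetilde v}^{-2}$; $\overline u_{j+1}=\overline u_j-\gamma_j\widetilde vL_\tau^T\overline w_j$. The normalized orthogonalized snapshots are $\vartheta_j=\widehat\gamma_j^{1/2}\overline u_j=\overline u_j/\|\overline u_j\|_{1/\widetilde v}$, $j=1,\ldots,n$; equivalently they are given by the Lanczos process $\vartheta_0=0$, $\vartheta_1=\widetilde b/\|\widetilde b\|_{1/\widetilde v}$, and for $j=1,2,\ldots$: $a_j^u=\langle\vartheta_j,\xi(\widetilde P)\vartheta_j\rangle_{1/\widetilde v}$; $r=[\xi(\widetilde P)-a_j^uI]\vartheta_j-b_{j-1}^u\vartheta_{j-1}$; $b_j^u=\|r\|_{1/\widetilde v}$; $\vartheta_{j+1}=r/b_j^u$. All of these are viewed as functions of $x$ through $\vartheta_j(x)=\vartheta_j(\widetilde x(x))$, $\overline u_j(x)=\overline u_j(\widetilde x(x))$.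
   Formalization: The printed formula b_n = (1/√c) V*b is false unless c = 1, since V*b = √c e_1 = b_n; it is replaced by b_n = V*b, with the addition that the printed formula holds exactly when c = 1. *)

theory Defs
  imports "HOL-Probability.Probability_Measure" "HOL-Computational_Algebra.Polynomial" "Jordan_Normal_Form.Matrix"
begin

section \<open>Weighted inner products and the operator \<open>A = - v\<^sup>2 d\<^sup>2/dx\<^sup>2\<close>\<close>

text \<open>Functions on an interval \<open>[0, X]\<close> are represented by total functions on the reals; their
  values outside the interval are irrelevant.\<close>

definition weighted_ip :: "(real \<Rightarrow> real) \<Rightarrow> real \<Rightarrow> (real \<Rightarrow> real) \<Rightarrow> (real \<Rightarrow> real) \<Rightarrow> real" where
  "weighted_ip \<rho> X f g = integral {0..X} (\<lambda>x. f x * g x * \<rho> x)"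

definition ip :: "(real \<Rightarrow> real) \<Rightarrow> real \<Rightarrow> (real \<Rightarrow> real) \<Rightarrow> (real \<Rightarrow> real) \<Rightarrow> real" where
  "ip v xm = weighted_ip (\<lambda>x. 1 / (v x)\<^sup>2) xm"

definition L2_on :: "real \<Rightarrow> (real \<Rightarrow> real) \<Rightarrow> bool" where
  "L2_on X g \<longleftrightarrow> g absolutely_integrable_on {0..X} \<and> (\<lambda>x. (g x)\<^sup>2) integrable_on {0..X}"

text \<open>\<open>A_graph v xm u w\<close> means that \<open>u\<close> is in the domain of \<open>A\<close> and \<open>A u = w\<close>.  The domain used here
  is the classical one. Since \<open>v\<close> is continuous and positive, an eigenfunction of the self-adjoint
  realization is automatically twice continuously differentiable, so both have the same eigenpairs.\<close>

definition A_graph :: "(real \<Rightarrow> real) \<Rightarrow> real \<Rightarrow> (real \<Rightarrow> real) \<Rightarrow> (real \<Rightarrow> real) \<Rightarrow> bool" where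
  "A_graph v xm u w \<longleftrightarrow>
     (\<exists>u' u''.
        (\<forall>x\<in>{0..xm}. (u has_real_derivative u' x) (at x within {0..xm})) \<and>
        (\<forall>x\<in>{0..xm}. (u' has_real_derivative u'' x) (at x within {0..xm})) \<and>
        continuous_on {0..xm} u'' \<and>
        u' 0 = 0 \<and> u xm = 0 \<and>
        (\<forall>x\<in>{0..xm}. w x = - (v x)\<^sup>2 * u'' x))"

definition A_eigenpair :: "(real \<Rightarrow> real) \<Rightarrow> real \<Rightarrow> real \<Rightarrow> (real \<Rightarrow> real) \<Rightarrow> bool" where
  "A_eigenpair v xm \<mu> w \<longleftrightarrow> A_graph v xm w (\<lambda>x. \<mu> * w x) \<and> (\<exists>x\<in>{0..xm}. w x \<noteq> 0)"

text \<open>An orthonormal enumeration (from index \<open>0\<close>) of all eigenpairs of \<open>A\<close>.\<close>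

definition A_eigenbasis ::
    "(real \<Rightarrow> real) \<Rightarrow> real \<Rightarrow> (nat \<Rightarrow> real) \<Rightarrow> (nat \<Rightarrow> real \<Rightarrow> real) \<Rightarrow> bool" where
  "A_eigenbasis v xm lam z \<longleftrightarrow>
     (\<forall>l. A_eigenpair v xm (lam l) (z l)) \<and>
     (\<forall>l k. ip v xm (z l) (z k) = (if l = k then 1 else 0)) \<and>
     (\<forall>\<mu> w. A_eigenpair v xm \<mu> w \<longrightarrow>
        (\<exists>l a. lam l = \<mu> \<and> (\<forall>x\<in>{0..xm}. w x = a * z l x)))"

text \<open>The spectral calculus \<open>h(A)\<close>.  The vector \<open>h(A)\<close> is applied to is given through the functional
  \<open>\<phi>\<close> pairing it with test functions, so that it can be a function \<open>g\<close> (with \<open>\<phi> = ip v xm g\<close>)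
  as well as the Dirac delta.\<close>

definition spectral_apply ::
    "(nat \<Rightarrow> real) \<Rightarrow> (nat \<Rightarrow> real \<Rightarrow> real) \<Rightarrow> (real \<Rightarrow> real) \<Rightarrow> ((real \<Rightarrow> real) \<Rightarrow> real) \<Rightarrow> real \<Rightarrow> real" where
  "spectral_apply lam z h \<phi> = (\<lambda>x. \<Sum>l. h (lam l) * \<phi> (z l) * z l x)"

text \<open>The right-half Dirac delta, as the functional pairing it with \<open>h\<close> in the inner product \<open>ip v xm\<close>.\<close>

definition delta0 :: "(real \<Rightarrow> real) \<Rightarrow> (real \<Rightarrow> real) \<Rightarrow> real" where
  "delta0 v h = h 0 / (v 0)\<^sup>2"

section \<open>The pulse \<open>q\<close> and the snapshots\<close>

definition smooth_L1 :: "nat \<Rightarrow> (real \<Rightarrow> real) \<Rightarrow> bool" where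
  "smooth_L1 N q \<longleftrightarrow>
     (\<forall>i<N. \<forall>t. ((deriv ^^ i) q) differentiable (at t)) \<and>
     continuous_on UNIV ((deriv ^^ N) q) \<and>
     (\<forall>i\<le>N. ((deriv ^^ i) q) absolutely_integrable_on UNIV)"

text \<open>The order made explicit for ``sufficiently smooth''.  It gives \<open>qtilde q s = O(s powr - 8)\<close>,
  which (using only that \<open>v\<close> is continuous and positive) makes the eigenfunction series of the
  snapshots and their first two derivatives converge absolutely and uniformly on \<open>[0, xm]\<close>.\<close>

definition pulse_order :: nat where
  "pulse_order = 16"

definition qtilde :: "(real \<Rightarrow> real) \<Rightarrow> real \<Rightarrow> real" where
  "qtilde q s = integral {0..} (\<lambda>t. 2 * cos (t * sqrt s) * q t)"

text \<open>Note that \<open>qtilde q (s\<^sup>2)\<close> is the Fourier transform of \<open>q\<close> at \<open>s\<close>.\<close>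

definition qtilde_A ::
    "(real \<Rightarrow> real) \<Rightarrow> real \<Rightarrow> (real \<Rightarrow> real) \<Rightarrow> (nat \<Rightarrow> real) \<Rightarrow> (nat \<Rightarrow> real \<Rightarrow> real) \<Rightarrow>
     (real \<Rightarrow> real) \<Rightarrow> real \<Rightarrow> real" where
  "qtilde_A v xm q lam z g = spectral_apply lam z (qtilde q) (ip v xm g)"

definition pulse_b ::
    "(real \<Rightarrow> real) \<Rightarrow> (real \<Rightarrow> real) \<Rightarrow> (nat \<Rightarrow> real) \<Rightarrow> (nat \<Rightarrow> real \<Rightarrow> real) \<Rightarrow> real \<Rightarrow> real" where
  "pulse_b v q lam z =
     (\<lambda>x. v 0 * spectral_apply lam z (\<lambda>s. sqrt (qtilde q s)) (delta0 v) x)"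

definition cos_sqrt_A ::
    "(real \<Rightarrow> real) \<Rightarrow> real \<Rightarrow> (nat \<Rightarrow> real) \<Rightarrow> (nat \<Rightarrow> real \<Rightarrow> real) \<Rightarrow> real \<Rightarrow>
     (real \<Rightarrow> real) \<Rightarrow> real \<Rightarrow> real" where
  "cos_sqrt_A v xm lam z t g = spectral_apply lam z (\<lambda>s. cos (t * sqrt s)) (ip v xm g)"

section \<open>The spectral measure\<close>

definition spectral_measure ::
    "(real \<Rightarrow> real) \<Rightarrow> (real \<Rightarrow> real) \<Rightarrow> (nat \<Rightarrow> real) \<Rightarrow> (nat \<Rightarrow> real \<Rightarrow> real) \<Rightarrow> real measure" where
  "spectral_measure v q lam z =
     distr (point_measure UNIV (\<lambda>l. ennreal (qtilde q (lam l) * (z l 0)\<^sup>2 / (v 0)\<^sup>2))) borel lam"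

definition eta0 ::
    "(real \<Rightarrow> real) \<Rightarrow> (real \<Rightarrow> real) \<Rightarrow> real \<Rightarrow> (nat \<Rightarrow> real) \<Rightarrow> (nat \<Rightarrow> real \<Rightarrow> real) \<Rightarrow> real measure" where
  "eta0 v q \<tau> lam z = distr (spectral_measure v q lam z) borel (\<lambda>s. cos (\<tau> * sqrt s))"

text \<open>Since \<open>eta0\<close> is carried by \<open>[-1, 1]\<close>, its distribution function extends by constants beyond the
  end points, and an atom at \<open>-1\<close> or \<open>1\<close> counts as a point of increase.\<close>

definition point_of_increase :: "(real \<Rightarrow> real) \<Rightarrow> real \<Rightarrow> bool" where
  "point_of_increase F s \<longleftrightarrow> (\<forall>\<epsilon>>0. F (s - \<epsilon>) < F (s + \<epsilon>))"

definition has_n_points_of_increase :: "nat \<Rightarrow> real measure \<Rightarrow> bool" where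
  "has_n_points_of_increase n M \<longleftrightarrow>
     (\<exists>S\<subseteq>{-1..1}. finite S \<and> card S = n \<and>
        (\<forall>s\<in>S. point_of_increase (\<lambda>r. measure M {-1..r}) s))"

section \<open>Quadrature data and the Jacobi matrix\<close>

fun cheb_T :: "nat \<Rightarrow> real \<Rightarrow> real" where
  "cheb_T 0 x = 1"
| "cheb_T (Suc 0) x = x"
| "cheb_T (Suc (Suc k)) x = 2 * x * cheb_T (Suc k) x - cheb_T k x"

definition quadrature_data ::
    "nat \<Rightarrow> (nat \<Rightarrow> real) \<Rightarrow> (nat \<Rightarrow> real) \<Rightarrow> (nat \<Rightarrow> real) \<Rightarrow> bool" where
  "quadrature_data n f \<theta> y \<longleftrightarrow>
     (\<forall>j\<in>{1..n}. y j > 0 \<and> \<theta> j \<in> {-1<..<1}) \<and> inj_on \<theta> {1..n} \<and>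
     (\<forall>k<2 * n. (\<Sum>j=1..n. (y j)\<^sup>2 * cheb_T k (\<theta> j)) = f k)"

definition quadrature_ip ::
    "nat \<Rightarrow> real \<Rightarrow> (nat \<Rightarrow> real) \<Rightarrow> (nat \<Rightarrow> real) \<Rightarrow> real poly \<Rightarrow> real poly \<Rightarrow> real" where
  "quadrature_ip n c \<theta> y p g = 1 / c * (\<Sum>j=1..n. (y j)\<^sup>2 * poly p (\<theta> j) * poly g (\<theta> j))"

text \<open>State \<open>j\<close> of the Lanczos process is \<open>(\<beta>\<^sub>j, q\<^sub>j, q\<^sub>j\<^sub>+\<^sub>1)\<close>; the value \<open>\<beta>\<^sub>0 = 0\<close> is immaterial because
  \<open>q\<^sub>0 = 0\<close>.\<close>

primrec lanczos ::
    "(real poly \<Rightarrow> real poly \<Rightarrow> real) \<Rightarrow> nat \<Rightarrow> real \<times> real poly \<times> real poly" where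
  "lanczos S 0 = (0, 0, 1)"
| "lanczos S (Suc j) =
     (case lanczos S j of (\<beta>, p, g) \<Rightarrow>
        let \<alpha> = S g ([:0, 1:] * g);
            r = ([:0, 1:] - [:\<alpha>:]) * g - Polynomial.smult \<beta> p;
            \<beta>' = sqrt (S r r)
        in (\<beta>', g, Polynomial.smult (1 / \<beta>') r))"

definition lanczos_alpha :: "(real poly \<Rightarrow> real poly \<Rightarrow> real) \<Rightarrow> nat \<Rightarrow> real" where
  "lanczos_alpha S j = (let g = fst (snd (lanczos S j)) in S g ([:0, 1:] * g))"

definition lanczos_beta :: "(real poly \<Rightarrow> real poly \<Rightarrow> real) \<Rightarrow> nat \<Rightarrow> real" where
  "lanczos_beta S j = fst (lanczos S j)"

text \<open>Matrix and vector entries are indexed from \<open>0\<close>, all families in the mathematics from \<open>1\<close>.\<close>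

definition jacobi_mat :: "nat \<Rightarrow> (nat \<Rightarrow> real) \<Rightarrow> (nat \<Rightarrow> real) \<Rightarrow> real mat" where
  "jacobi_mat n \<alpha> \<beta> = mat n n (\<lambda>(i, j).
     if i = j then \<alpha> (i + 1)
     else if j = i + 1 then \<beta> (i + 1)
     else if i = j + 1 then \<beta> (j + 1)
     else 0)"

section \<open>Orthogonalized snapshots\<close>

definition travel_time :: "(real \<Rightarrow> real) \<Rightarrow> real \<Rightarrow> real" where
  "travel_time v x = integral {0..x} (\<lambda>s. 1 / v s)"

definition travel_time_inv :: "(real \<Rightarrow> real) \<Rightarrow> real \<Rightarrow> real \<Rightarrow> real" where
  "travel_time_inv v xm = the_inv_into {0..xm} (travel_time v)"

definition deriv_on :: "real \<Rightarrow> (real \<Rightarrow> real) \<Rightarrow> real \<Rightarrow> real" where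
  "deriv_on X f s = vector_derivative f (at s within {0..X})"

text \<open>In the following, \<open>X\<close>, \<open>vt\<close> and \<open>zt\<close> are the length of the interval, the velocity and the
  eigenfunctions in the travel time coordinate.\<close>

definition L_op ::
    "(real \<Rightarrow> real) \<Rightarrow> real \<Rightarrow> real \<Rightarrow> (nat \<Rightarrow> real) \<Rightarrow> (nat \<Rightarrow> real \<Rightarrow> real) \<Rightarrow>
     (real \<Rightarrow> real) \<Rightarrow> real \<Rightarrow> real" where
  "L_op vt X \<tau> lam zt f =
     (\<lambda>s. 2 / \<tau> * deriv_on X
        (spectral_apply lam zt (\<lambda>r. sin (\<tau> / 2 * sqrt r) / sqrt r)
           (weighted_ip (\<lambda>r. 1 / vt r) X f)) s)"

definition LT_op ::
    "(real \<Rightarrow> real) \<Rightarrow> real \<Rightarrow> real \<Rightarrow> (nat \<Rightarrow> real) \<Rightarrow> (nat \<Rightarrow> real \<Rightarrow> real) \<Rightarrow>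
     (real \<Rightarrow> real) \<Rightarrow> real \<Rightarrow> real" where
  "LT_op vt X \<tau> lam zt g =
     (\<lambda>s. - (2 / \<tau>) * (1 / vt s) *
        spectral_apply lam zt (\<lambda>r. sin (\<tau> / 2 * sqrt r) / sqrt r)
          (weighted_ip (\<lambda>r. 1 / vt r) X (\<lambda>r. vt r * deriv_on X g r)) s)"

text \<open>State \<open>j\<close> of the snapshot orthogonalization is \<open>(w\<^sub>j, u\<^sub>j\<^sub>+\<^sub>1)\<close>.\<close>

primrec orth_process ::
    "(real \<Rightarrow> real) \<Rightarrow> real \<Rightarrow> real \<Rightarrow> (nat \<Rightarrow> real) \<Rightarrow> (nat \<Rightarrow> real \<Rightarrow> real) \<Rightarrow> (real \<Rightarrow> real) \<Rightarrow>
     nat \<Rightarrow> (real \<Rightarrow> real) \<times> (real \<Rightarrow> real)" where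
  "orth_process vt X \<tau> lam zt bt 0 = ((\<lambda>s. 0), bt)"
| "orth_process vt X \<tau> lam zt bt (Suc j) =
     (case orth_process vt X \<tau> lam zt bt j of (w, u) \<Rightarrow>
        let \<gamma>' = 1 / weighted_ip (\<lambda>s. 1 / vt s) X u u;
            w' = (\<lambda>s. w s + \<gamma>' * (1 / vt s) * L_op vt X \<tau> lam zt u s);
            \<gamma> = 1 / weighted_ip vt X w' w';
            u' = (\<lambda>s. u s - \<gamma> * vt s * LT_op vt X \<tau> lam zt w' s)
        in (w', u'))"

text \<open>The orthogonalized snapshots \<open>u\<^sub>j\<close> (\<open>j \<ge> 1\<close>) as functions of the travel time; then these and their
  normalizations as functions of \<open>x\<close>.\<close>

definition orth_snapshot_travel ::
    "(real \<Rightarrow> real) \<Rightarrow> real \<Rightarrow> (real \<Rightarrow> real) \<Rightarrow> real \<Rightarrow> (nat \<Rightarrow> real) \<Rightarrow> (nat \<Rightarrow> real \<Rightarrow> real) \<Rightarrow>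
     nat \<Rightarrow> real \<Rightarrow> real" where
  "orth_snapshot_travel v xm b \<tau> lam z j =
     (let xi = travel_time_inv v xm
      in snd (orth_process (v \<circ> xi) (travel_time v xm) \<tau> lam (\<lambda>l. z l \<circ> xi) (b \<circ> xi) (j - 1)))"

definition orth_snapshot ::
    "(real \<Rightarrow> real) \<Rightarrow> real \<Rightarrow> (real \<Rightarrow> real) \<Rightarrow> real \<Rightarrow> (nat \<Rightarrow> real) \<Rightarrow> (nat \<Rightarrow> real \<Rightarrow> real) \<Rightarrow>
     nat \<Rightarrow> real \<Rightarrow> real" where
  "orth_snapshot v xm b \<tau> lam z j = orth_snapshot_travel v xm b \<tau> lam z j \<circ> travel_time v"

definition normalized_snapshot ::
    "(real \<Rightarrow> real) \<Rightarrow> real \<Rightarrow> (real \<Rightarrow> real) \<Rightarrow> real \<Rightarrow> (nat \<Rightarrow> real) \<Rightarrow> (nat \<Rightarrow> real \<Rightarrow> real) \<Rightarrow>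
     nat \<Rightarrow> real \<Rightarrow> real" where
  "normalized_snapshot v xm b \<tau> lam z j =
     (let ut = orth_snapshot_travel v xm b \<tau> lam z j;
          vt = v \<circ> travel_time_inv v xm
      in (\<lambda>x. orth_snapshot v xm b \<tau> lam z j x /
              sqrt (weighted_ip (\<lambda>s. 1 / vt s) (travel_time v xm) ut ut)))"

section \<open>Rows of functions\<close>

text \<open>Linear span in the space of functions on \<open>S\<close>.\<close>

definition span_on :: "real set \<Rightarrow> nat set \<Rightarrow> (nat \<Rightarrow> real \<Rightarrow> real) \<Rightarrow> (real \<Rightarrow> real) set" where
  "span_on S I F = {restrict (\<lambda>x. \<Sum>k\<in>I. a k * F k x) S |a. True}"

definition krylov ::
    "real set \<Rightarrow> nat \<Rightarrow> (real \<Rightarrow> real) \<Rightarrow> ((real \<Rightarrow> real) \<Rightarrow> real \<Rightarrow> real) \<Rightarrow> (real \<Rightarrow> real) set" where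
  "krylov S n g P = span_on S {0..<n} (\<lambda>k. (P ^^ k) g)"

definition star_mat ::
    "(real \<Rightarrow> real) \<Rightarrow> real \<Rightarrow> nat \<Rightarrow> (nat \<Rightarrow> real \<Rightarrow> real) \<Rightarrow> (nat \<Rightarrow> real \<Rightarrow> real) \<Rightarrow> real mat" where
  "star_mat v xm n W G = mat n n (\<lambda>(i, j). ip v xm (W (i + 1)) (G (j + 1)))"

text \<open>A pitfall of normalization: the first normalized snapshot is \<open>b\<close> divided by its norm \<open>sqrt c\<close>,
  so the coefficient vector \<open>V\<^sup>* b\<close> is \<open>sqrt c e\<^sub>1\<close>, whereas \<open>(1 / sqrt c) V\<^sup>* b\<close> is \<open>e\<^sub>1\<close>.\<close>

definition star_vec ::
    "(real \<Rightarrow> real) \<Rightarrow> real \<Rightarrow> nat \<Rightarrow> (nat \<Rightarrow> real \<Rightarrow> real) \<Rightarrow> (real \<Rightarrow> real) \<Rightarrow> real vec" where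
  "star_vec v xm n W g = vec n (\<lambda>i. ip v xm (W (i + 1)) g)"

end

theory Submission
  imports Defs
begin

text \<open>
  In the eigenbasis of \<open>A\<close> the pulse is \<open>b = \<Sum>\<^sub>l b\<^sub>l z\<^sub>l\<close>, the propagator \<open>P\<close> multiplies the
  \<open>l\<close>-th coefficient by \<open>\<mu>\<^sub>l = cos (\<tau> sqrt \<lambda>\<^sub>l)\<close>, and every function that occurs is \<open>p(P) b\<close> for a
  polynomial \<open>p\<close>. Inner products become moments,
  \<open>\<langle>\<langle>p(P) b, g(P) b\<rangle>\<rangle> = M (p g)\<close> with \<open>M p = \<Sum>\<^sub>l p(\<mu>\<^sub>l) b\<^sub>l\<^sup>2\<close>, and the data are
  \<open>f\<^sub>k = M T\<^sub>k\<close>. The quadrature reproduces \<open>M\<close> below degree \<open>2n\<close>, because the Chebyshev polynomials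
  span there (\<open>quadrature_exact\<close>); since a nonzero polynomial of degree less than \<open>n\<close> cannot vanish at
  all \<open>n\<close> nodes, \<open>M\<close> is positive definite below degree \<open>n\<close>.

  Both matrices then come from one family of polynomials. The operators \<open>L\<^sub>\<tau>\<close> and \<open>L\<^sub>\<tau>\<^sup>T\<close> factor
  \<open>(2 / \<tau>\<^sup>2) (1 - P)\<close>, so the orthogonalization of the snapshots is a conjugate gradient recursion for
  polynomials (\<open>orth_process_eq\<close>); it produces \<open>M\<close>-orthogonal polynomials, one of each degree, with
  positive leading coefficients (\<open>orthogonality\<close>, \<open>degrees_and_leads\<close>). Orthonormal polynomials with
  positive leading coefficients are unique, so the Lanczos process on the quadrature data runs through
  the same ones (\<open>lanczos_reproduces_orthonormal_family\<close>), up to the factor \<open>sqrt c\<close> that stems from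
  the normalization \<open>1 / c\<close> of its inner product. Its coefficients are the entries
  \<open>\<langle>\<langle>\<vartheta>\<^sub>i, P \<vartheta>\<^sub>j\<rangle>\<rangle>\<close>. All spans agree with \<open>{p(P) b | deg p < n}\<close>, because each family has exactly one
  polynomial of each degree.

  The analysis has to justify the manipulation of the eigenfunction series and of their derivatives.
  The derivatives \<open>z\<^sub>l'\<close> are orthogonal with squared norms \<open>\<lambda>\<^sub>l\<close>, and Bessel's inequality for them and
  an indicator function gives \<open>\<Sum>\<^sub>l z\<^sub>l(x)\<^sup>2 / \<lambda>\<^sub>l \<le> xm - x\<close>. From this follow \<open>\<Sum>\<^sub>l 1 / \<lambda>\<^sub>l < \<infinity>\<close> and
  \<open>z\<^sub>l, z\<^sub>l' = O(\<lambda>\<^sub>l)\<close>. The smoothness of \<open>q\<close> makes its Fourier transform, and with it \<open>b\<^sub>l\<close>, decay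
  faster than these bounds grow.
\<close>


section \<open>Orthogonal polynomials of a positive functional\<close>

lemma triangular_family_spans:
  fixes g :: "nat \<Rightarrow> real poly"
  assumes "\<And>i. i < n \<Longrightarrow> degree (g i) = i" "\<And>i. i < n \<Longrightarrow> g i \<noteq> 0" "degree p < n"
  shows "\<exists>a. p = (\<Sum>i<n. Polynomial.smult (a i) (g i))"
proof -
  have "\<exists>a. p = (\<Sum>i<m. Polynomial.smult (a i) (g i))" if "m \<le> n" "p = 0 \<or> degree p < m" for p m
    using that
  proof (induction m arbitrary: p)
    case 0
    then show ?case by auto
  next
    case (Suc m)
    define t where "t = coeff p m / lead_coeff (g m)"
    define r where "r = p - Polynomial.smult t (g m)"
    have gm: "degree (g m) = m" "coeff (g m) m \<noteq> 0"
      using assms(1)[of m] assms(2)[of m] Suc.prems(1) leading_coeff_0_iff[of "g m"] by auto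
    have "degree r \<le> m"
      unfolding r_def using Suc.prems gm
      by (intro degree_diff_le order.trans[OF degree_smult_le]) auto
    moreover have "coeff r m = 0" using gm by (simp add: r_def t_def)
    ultimately have "r = 0 \<or> degree r < m"
      by (metis leading_coeff_0_iff le_neq_implies_less)
    then obtain a where a: "r = (\<Sum>i<m. Polynomial.smult (a i) (g i))" using Suc.IH[of r] Suc.prems by auto
    have "p = (\<Sum>i<Suc m. Polynomial.smult ((a(m := t)) i) (g i))"
      using a by (simp add: r_def algebra_simps)
    then show ?case by blast
  qed
  from this[of n p] assms(3) show ?thesis by simp
qed

text \<open>Positivity is confined to degrees below \<open>n\<close>, as is natural for a functional known only through \<open>n\<close>
  quadrature nodes. For \<open>n = 0\<close> the locale expresses plain linearity.\<close>

locale positive_moments =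
  fixes M :: "real poly \<Rightarrow> real" and n :: nat
  assumes add: "M (p + g) = M p + M g"
    and scale: "M (Polynomial.smult a p) = a * M p"
    and pos: "p \<noteq> 0 \<Longrightarrow> degree p < n \<Longrightarrow> M (p * p) > 0"
begin

lemma zero [simp]: "M 0 = 0" using scale[of 0 0] by simp

lemma minus: "M (- p) = - M p" using scale[of "-1" p] by simp

lemma diff: "M (p - g) = M p - M g" using add[of p "- g"] minus[of g] by simp

lemma sum: "M (\<Sum>i\<in>A. h i) = (\<Sum>i\<in>A. M (h i))"
  by (induction A rule: infinite_finite_induct) (auto simp: add)

lemmas linear = add scale minus diff

text \<open>The family spans all polynomials of degree less than \<open>m\<close>, so \<open>p\<close> is orthogonal to itself.\<close>

lemma orthogonal_to_triangular_family_imp_zero: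
  assumes "\<And>i. i < m \<Longrightarrow> degree (g i) = i" "\<And>i. i < m \<Longrightarrow> g i \<noteq> 0" "m \<le> n"
    and "degree p < m" "\<And>i. i < m \<Longrightarrow> M (g i * p) = 0"
  shows "p = 0"
proof (rule ccontr)
  assume "p \<noteq> 0"
  obtain a where a: "p = (\<Sum>i<m. Polynomial.smult (a i) (g i))"
    using triangular_family_spans[of m g p] assms by blast
  have "M (p * p) = M (\<Sum>i<m. Polynomial.smult (a i) (g i * p))"
    by (subst a) (simp add: sum_distrib_right)
  also have "\<dots> = 0" using assms(5) by (simp add: sum scale)
  finally show False using pos[OF \<open>p \<noteq> 0\<close>] assms by simp
qed

lemma orthogonal_to_lower_degree:
  assumes "\<And>i. i < n \<Longrightarrow> degree (g i) = i" "\<And>i. i < n \<Longrightarrow> g i \<noteq> 0"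
    and "\<And>i. i < j \<Longrightarrow> M (g i * g j) = 0" "j < n" "degree p < j"
  shows "M (p * g j) = 0"
proof -
  obtain a where a: "p = (\<Sum>i<j. Polynomial.smult (a i) (g i))"
    using triangular_family_spans[of j g p] assms by auto
  have "M (p * g j) = M (\<Sum>i<j. Polynomial.smult (a i) (g i * g j))"
    by (subst a) (simp add: sum_distrib_right)
  also have "\<dots> = 0" using assms(3) by (simp add: sum scale)
  finally show ?thesis .
qed

text \<open>Orthonormal polynomials with positive leading coefficients are unique, so the Lanczos process
  has to run through any such family that is given. State \<open>j\<close> of the process contains the polynomials
  number \<open>j - 1\<close> and \<open>j\<close> of the family, which is numbered from \<open>0\<close>.\<close>

lemma lanczos_reproduces_orthonormal_family:
  fixes g :: "nat \<Rightarrow> real poly"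
  assumes S: "\<And>p r. S p r = M (p * r)"
    and deg: "\<And>i. i < n \<Longrightarrow> degree (g i) = i"
    and lead: "\<And>i. i < n \<Longrightarrow> lead_coeff (g i) > 0"
    and orth: "\<And>i j. i < n \<Longrightarrow> j < n \<Longrightarrow> M (g i * g j) = (if i = j then 1 else 0)"
    and one: "M 1 = 1" and "j < n"
  shows "lanczos S j = (if j = 0 then (0, 0, g 0)
     else (M (g j * ([:0, 1:] * g (j - 1))), g (j - 1), g j))"
  using \<open>j < n\<close>
proof (induction j)
  case 0
  obtain a where a: "g 0 = [:a:]" using deg[of 0] 0 by (auto dest: degree0_coeffs)
  have "a > 0" using lead[of 0] 0 a by simp
  moreover have "a * a * M 1 = 1" using orth[of 0 0] 0 scale[of "a * a" 1] a by simp
  ultimately have "a = 1" using one by (simp add: square_eq_1_iff)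
  then show ?case using a by (simp add: one_pCons)
next
  case (Suc j)
  let ?X = "[:0, 1:] :: real poly"
  let ?\<kappa> = "M (g (Suc j) * (?X * g j))"
  define \<alpha> where "\<alpha> = M (g j * (?X * g j))"
  define p where "p = (if j = 0 then 0 else Polynomial.smult (M (g j * (?X * g (j - 1)))) (g (j - 1)))"
  define r where "r = (?X - [:\<alpha>:]) * g j - p"
  have j: "j < n" using Suc.prems by simp
  have nz: "g i \<noteq> 0" if "i < n" for i using lead[OF that] by auto
  have low: "M (q * g k) = 0" if "degree q < k" "k < n" for q k
    using orthogonal_to_lower_degree[of g k q] deg nz orth that by auto
  have degX: "degree (?X * g j) = Suc j" "lead_coeff (?X * g j) = lead_coeff (g j)"
    using deg[OF j] nz[OF j] by (auto simp: degree_mult_eq lead_coeff_mult)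
  have degp: "degree p < Suc j" using deg[of "j - 1"] j by (auto simp: p_def)
  have r_eq: "r = ?X * g j - (Polynomial.smult \<alpha> (g j) + p)" by (simp add: r_def algebra_simps)
  have degr: "degree (Polynomial.smult \<alpha> (g j) + p) < Suc j"
    using degp deg[OF j] by (intro degree_add_less) (auto intro: le_less_trans[OF degree_smult_le])
  have "coeff r (Suc j) = lead_coeff (g j)"
    using degX coeff_eq_0[OF degr] unfolding r_eq by (simp add: coeff_diff)
  moreover have "degree r \<le> Suc j"
    unfolding r_eq using degX degr by (intro degree_diff_le) auto
  ultimately have r: "degree r = Suc j" "lead_coeff r = lead_coeff (g j)"
    using nz[OF j] by (metis le_antisym le_degree leading_coeff_0_iff)+
  \<comment> \<open>The remainder \<open>r\<close> is orthogonal to all earlier polynomials, hence a multiple of the next one; the leading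
    coefficients give the factor \<open>t\<close>, and show that it is positive, as the square root in the process is.\<close>
  define t where "t = lead_coeff r / lead_coeff (g (Suc j))"
  have "t > 0" using r lead[OF j] lead[OF Suc.prems] by (simp add: t_def)
  \<comment> \<open>Self-adjointness of multiplication by \<open>X\<close> leaves only the two terms that the step removes.\<close>
  have orth_r: "M (g i * r) = 0" if "i \<le> j" for i
  proof -
    have shift: "M (g i * (?X * g j)) = M (?X * g i * g j)" by (simp add: algebra_simps)
    have "M (g i * (?X * g j)) = (if i = j then \<alpha> else if Suc i = j then M (g j * (?X * g i)) else 0)"
    proof (cases "Suc i < j")
      case True
      then have "degree (?X * g i) < j" using deg[of i] nz[of i] j by (simp add: degree_mult_eq)
      from low[OF this j] shift True show ?thesis by simp
    next
      case False
      then have "i = j \<or> Suc i = j" using that by auto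
      then show ?thesis using shift by (auto simp: \<alpha>_def mult_ac)
    qed
    moreover have "M (g i * p) = (if Suc i = j then M (g j * (?X * g i)) else 0)"
      using orth[of i "j - 1"] that j by (auto simp: p_def scale)
    ultimately show ?thesis using orth[of i j] that j
      by (auto simp: r_eq linear distrib_left right_diff_distrib)
  qed
  have "r - Polynomial.smult t (g (Suc j)) = 0"
  proof (rule orthogonal_to_triangular_family_imp_zero[of "Suc (Suc j)" g])
    show "M (g i * (r - Polynomial.smult t (g (Suc j)))) = 0" if "i < Suc (Suc j)" for i
    proof (cases "i = Suc j")
      case False
      then show ?thesis using orth_r[of i] orth[of i "Suc j"] that Suc.prems
        by (simp add: linear right_diff_distrib)
    next
      case True
      have "degree (r - Polynomial.smult t (g (Suc j))) < Suc j"
      proof -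
        have "degree (r - Polynomial.smult t (g (Suc j))) \<le> Suc j"
          using r deg[OF Suc.prems] by (intro degree_diff_le order.trans[OF degree_smult_le]) auto
        moreover have "coeff (r - Polynomial.smult t (g (Suc j))) (Suc j) = 0"
          using r deg[OF Suc.prems] lead[OF Suc.prems] by (simp add: t_def)
        ultimately show ?thesis
          by (metis coeff_0_degree_minus_1 leading_coeff_0_iff le_neq_implies_less degree_0 zero_less_Suc)
      qed
      from low[OF this Suc.prems] True show ?thesis by (simp add: mult.commute)
    qed
  qed (use Suc.prems deg nz r in \<open>auto intro!: degree_diff_less intro: le_less_trans[OF degree_smult_le]\<close>)
  then have r_t: "r = Polynomial.smult t (g (Suc j))" by simp
  then have "M (g (Suc j) * r) = t" using orth[of "Suc j" "Suc j"] Suc.prems by (simp add: scale)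
  moreover have "M (g (Suc j) * r) = ?\<kappa>"
    using low[OF degr Suc.prems] by (simp add: r_eq right_diff_distrib diff mult.commute)
  ultimately have "t = ?\<kappa>" by simp
  have "M (r * r) = t * t" using orth[of "Suc j" "Suc j"] Suc.prems by (simp add: r_t scale)
  then have "sqrt (S r r) = t" using \<open>t > 0\<close> S by (simp add: real_sqrt_mult)
  moreover have "lanczos S (Suc j) = (sqrt (S r r), g j, Polynomial.smult (1 / sqrt (S r r)) r)"
  proof -
    define \<beta> where "\<beta> = (if j = 0 then 0 else M (g j * (?X * g (j - 1))))"
    define h where "h = (if j = 0 then 0 else g (j - 1))"
    have IH: "lanczos S j = (\<beta>, h, g j)" using Suc.IH[OF j] by (simp add: \<beta>_def h_def)
    have p: "p = Polynomial.smult \<beta> h" by (simp add: p_def \<beta>_def h_def)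
    have \<alpha>: "S (g j) (?X * g j) = \<alpha>" by (simp only: S \<alpha>_def)
    show ?thesis unfolding lanczos.simps IH prod.case Let_def \<alpha> r_def p ..
  qed
  ultimately show ?case using r_t \<open>t > 0\<close> \<open>t = ?\<kappa>\<close> by simp
qed
end


text \<open>The conjugate gradient form of the Lanczos process. The pair number \<open>j\<close> will represent
  the state \<open>(w\<^sub>j, u\<^sub>j\<^sub>+\<^sub>1)\<close> of the snapshot orthogonalization.\<close>

primrec coupled_polys ::
    "(real poly \<Rightarrow> real) \<Rightarrow> real poly \<Rightarrow> nat \<Rightarrow> real poly \<times> real poly" where
  "coupled_polys M D 0 = (0, 1)"
| "coupled_polys M D (Suc j) =
     (case coupled_polys M D j of (s, p) \<Rightarrow>
        let s' = s + Polynomial.smult (1 / M (p * p)) p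
        in (s', p - Polynomial.smult (1 / M (D * (s' * s'))) (D * s')))"

locale coupled_recursion = positive_moments +
  fixes D :: "real poly"
  assumes degree_D: "degree D = 1" and lead_D: "lead_coeff D < 0"
    and pos_D: "p \<noteq> 0 \<Longrightarrow> degree p < n \<Longrightarrow> M (D * (p * p)) > 0"
begin

abbreviation "sp j \<equiv> fst (coupled_polys M D j)"
abbreviation "pp j \<equiv> snd (coupled_polys M D j)"

lemma pp_0: "pp 0 = 1" by simp

lemma sp_Suc: "sp (Suc j) = sp j + Polynomial.smult (1 / M (pp j * pp j)) (pp j)"
  by (simp add: Let_def split: prod.split)

lemma pp_Suc: "pp (Suc j) = pp j -
    Polynomial.smult (1 / M (D * (sp (Suc j) * sp (Suc j)))) (D * sp (Suc j))"
  by (simp add: Let_def split: prod.split)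

declare coupled_polys.simps(2) [simp del]

text \<open>In each step a multiple of \<open>D\<close> is subtracted, so the negative leading coefficient of \<open>D\<close> keeps
  the leading coefficients positive. The nonzero polynomials obtained this way have positive norms, which
  the next division needs.\<close>

lemma degrees_and_leads:
  "j < n \<Longrightarrow> degree (pp j) = j \<and> lead_coeff (pp j) > 0 \<and>
     degree (sp (Suc j)) = j \<and> lead_coeff (sp (Suc j)) > 0"
proof (induction j)
  have lead_add: "degree (a + b) = k \<and> lead_coeff (a + b) > 0"
    if "degree a < k \<or> a = 0" "degree b = k" "lead_coeff b > 0" for a b :: "real poly" and k
    using that degree_add_eq_right[of a b] coeff_eq_0[of a k] by auto
  have s_step: "degree (sp (Suc j)) = j \<and> lead_coeff (sp (Suc j)) > 0"
    if "j < n" "degree (pp j) = j" "lead_coeff (pp j) > 0" "degree (sp j) < j \<or> sp j = 0" for j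
  proof -
    have "pp j \<noteq> 0" using that(3) by (metis coeff_0 less_irrefl)
    then have "M (pp j * pp j) > 0" using pos[of "pp j"] that by auto
    with that show ?thesis unfolding sp_Suc by (intro lead_add) auto
  qed
  {
    case 0
    have "degree (sp (Suc 0)) = 0 \<and> lead_coeff (sp (Suc 0)) > 0"
      by (rule s_step) (use 0 in auto)
    then show ?case by (auto simp: pp_0)
  next
    case (Suc j)
    then have IH: "degree (pp j) = j" "lead_coeff (pp j) > 0"
        "degree (sp (Suc j)) = j" "lead_coeff (sp (Suc j)) > 0" by auto
    have nz: "D \<noteq> 0" "sp (Suc j) \<noteq> 0"
      using lead_D IH(4) by (metis coeff_0 less_irrefl)+
    have pos': "M (D * (sp (Suc j) * sp (Suc j))) > 0" (is "?N > 0")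
      using pos_D[OF nz(2)] IH Suc.prems by auto
    have "degree (pp (Suc j)) = Suc j \<and> lead_coeff (pp (Suc j)) > 0"
      unfolding pp_Suc diff_conv_add_uminus
    proof (rule lead_add)
      show "degree (- Polynomial.smult (1 / ?N) (D * sp (Suc j))) = Suc j"
        using pos' nz IH degree_D by (simp add: degree_mult_eq)
      have "lead_coeff (- Polynomial.smult (1 / ?N) (D * sp (Suc j))) =
          (- lead_coeff D) * lead_coeff (sp (Suc j)) / ?N"
        using pos'
        by (simp only: degree_minus degree_smult_eq coeff_minus coeff_smult lead_coeff_mult)
          (simp add: lead_coeff_mult)
      also have "\<dots> > 0" using lead_D IH pos' by (intro divide_pos_pos mult_pos_pos) auto
      finally show "lead_coeff (- Polynomial.smult (1 / ?N) (D * sp (Suc j))) > 0" .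
    qed (use IH in auto)
    then show ?case using s_step[of "Suc j"] IH Suc.prems by auto
  }
qed

lemma norm_pp: "j < n \<Longrightarrow> M (pp j * pp j) > 0"
  using degrees_and_leads[of j] by (intro pos) (metis coeff_0 less_irrefl, simp)

lemma norm_sp: "j < n \<Longrightarrow> M (D * (sp (Suc j) * sp (Suc j))) > 0"
  using degrees_and_leads[of j] by (intro pos_D) (metis coeff_0 less_irrefl, simp)

lemma pp_as_difference: "j < n \<Longrightarrow> pp j = Polynomial.smult (M (pp j * pp j)) (sp (Suc j) - sp j)"
  using norm_pp[of j] by (simp add: sp_Suc)

lemma D_sp_as_difference: "j < n \<Longrightarrow>
    D * sp (Suc j) = Polynomial.smult (M (D * (sp (Suc j) * sp (Suc j)))) (pp j - pp (Suc j))"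
  using norm_sp[of j] by (simp add: pp_Suc)

text \<open>The two orthogonality relations support each other: \<open>p\<^sub>i\<close> is a multiple of a difference of
  consecutive \<open>s\<close>, and \<open>D s\<^sub>i\<close> of a difference of consecutive \<open>p\<close>.\<close>

lemma orthogonality:
  "j < n \<Longrightarrow> (\<forall>i<j. M (pp i * pp j) = 0) \<and> (\<forall>i\<le>j. M (D * (sp i * sp (Suc j))) = 0)"
proof (induction j)
  case 0
  then show ?case by simp
next
  case (Suc j)
  let ?h = "\<lambda>j. M (pp j * pp j)" and ?N = "\<lambda>j. M (D * (sp j * sp j))"
  have j: "j < n" using Suc.prems by simp
  have IHp: "M (pp i * pp j) = 0" if "i < j" for i using Suc that j by auto
  have IHs: "M (D * (sp i * sp (Suc j))) = 0" if "i \<le> j" for i using Suc that j by auto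
  have p: "M (pp i * pp (Suc j)) = 0" if "i \<le> j" for i
  proof -
    have "M (D * (pp i * sp (Suc j))) = ?h i * (M (D * (sp (Suc i) * sp (Suc j))) - M (D * (sp i * sp (Suc j))))"
      using that j by (subst pp_as_difference) (auto simp: linear algebra_simps)
    also have "\<dots> = (if i = j then ?h j * ?N (Suc j) else 0)"
      using that IHs[of i] IHs[of "Suc i"] by auto
    finally have "M (pp i * (D * sp (Suc j))) = (if i = j then ?h j * ?N (Suc j) else 0)"
      by (simp add: mult.left_commute)
    moreover have "M (pp i * pp (Suc j)) = M (pp i * pp j) - M (pp i * (D * sp (Suc j))) / ?N (Suc j)"
      by (simp add: pp_Suc right_diff_distrib linear)
    ultimately show ?thesis using IHp[of i] that norm_sp[OF j] by (auto split: if_splits)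
  qed
  have "M (D * (sp i * sp (Suc (Suc j)))) = 0" if "i \<le> Suc j" for i
  proof (cases i)
    case 0
    then show ?thesis by simp
  next
    case (Suc k)
    have "M (D * sp (Suc k) * pp (Suc j)) = ?N (Suc k) * (M (pp k * pp (Suc j)) - M (pp (Suc k) * pp (Suc j)))"
      using Suc that j by (subst D_sp_as_difference) (auto simp: linear algebra_simps)
    also have "\<dots> = (if k = j then - ?N (Suc j) * ?h (Suc j) else 0)"
      using p[of k] p[of "Suc k"] Suc that by auto
    finally have "M (D * (sp i * pp (Suc j))) = (if k = j then - ?N (Suc j) * ?h (Suc j) else 0)"
      using Suc by (simp add: mult.assoc)
    moreover have "M (D * (sp i * sp (Suc (Suc j)))) =
        M (D * (sp i * sp (Suc j))) + M (D * (sp i * pp (Suc j))) / ?h (Suc j)"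
      by (simp add: sp_Suc[of "Suc j"] distrib_left linear)
    ultimately show ?thesis using IHs[of i] Suc that norm_pp[OF Suc.prems] by (auto split: if_splits)
  qed
  then show ?case using p by (auto simp: less_Suc_eq_le)
qed

lemma pp_orthogonal:
  assumes "i < n" "j < n" "i \<noteq> j"
  shows "M (pp i * pp j) = 0"
  using orthogonality[of i] orthogonality[of j] assms
  by (metis linorder_neqE_nat mult.commute)

end

section \<open>Chebyshev polynomials\<close>

fun cheb_poly :: "nat \<Rightarrow> real poly" where
  "cheb_poly 0 = 1"
| "cheb_poly (Suc 0) = [:0, 1:]"
| "cheb_poly (Suc (Suc k)) = [:0, 2:] * cheb_poly (Suc k) - cheb_poly k"

lemma poly_cheb_poly: "poly (cheb_poly k) x = cheb_T k x"
  by (induction k rule: cheb_poly.induct) auto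

lemma degree_cheb_poly: "degree (cheb_poly k) = k \<and> cheb_poly k \<noteq> 0"
proof (induction k rule: cheb_poly.induct)
  case (3 k)
  then have d: "degree ([:0, 2:] * cheb_poly (Suc k)) = Suc (Suc k)"
    by (subst degree_mult_eq) auto
  have "degree ([:0, 2:] * cheb_poly (Suc k) + (- cheb_poly k)) = Suc (Suc k)"
    using d 3 by (subst degree_add_eq_left) auto
  then show ?case by auto
qed auto

lemma cheb_T_cos: "cheb_T k (cos t) = cos (real k * t)"
proof (induction k rule: cheb_poly.induct)
  case (3 k)
  have "cos (real (Suc (Suc k)) * t) + cos (real k * t) = 2 * cos t * cos (real (Suc k) * t)"
    using cos_plus_cos[of "real (Suc (Suc k)) * t" "real k * t"]
    by (simp add: algebra_simps add_divide_distrib diff_divide_distrib)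
  with 3 show ?case by simp
qed auto


section \<open>Fourier decay\<close>

text \<open>Otherwise \<open>\<bar>F\<bar>\<close> would be at least \<open>e\<close> on an interval of length \<open>k\<close> and have an integral of at least
  \<open>e k\<close>. The length \<open>k\<close> does not depend on the position of the interval.\<close>

lemma integrable_takes_small_values:
  fixes F :: "real \<Rightarrow> real"
  assumes F: "F absolutely_integrable_on UNIV" and "e > 0"
  obtains k where "k > 0" "\<And>c. \<exists>t\<in>{c..c + k}. \<bar>F t\<bar> < e"
proof -
  define J where "J = integral UNIV (\<lambda>t. \<bar>F t\<bar>)"
  have int: "(\<lambda>t. \<bar>F t\<bar>) integrable_on UNIV"
    using F by (simp add: absolutely_integrable_on_def)
  have "J \<ge> 0" unfolding J_def by (rule integral_nonneg[OF int]) simp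
  define k where "k = J / e + 1"
  have "k > 0" using \<open>J \<ge> 0\<close> \<open>e > 0\<close> by (simp add: k_def add_nonneg_pos)
  moreover have "\<exists>t\<in>{c..c + k}. \<bar>F t\<bar> < e" for c
  proof (rule ccontr)
    assume "\<not> ?thesis"
    then have large: "e \<le> \<bar>F t\<bar>" if "t \<in> {c..c + k}" for t using that by force
    have sub: "(\<lambda>t. \<bar>F t\<bar>) integrable_on {c..c + k}"
      using integrable_on_subinterval[OF int] by simp
    have "e * k = integral {c..c + k} (\<lambda>t. e)" using \<open>k > 0\<close> by simp
    also have "\<dots> \<le> integral {c..c + k} (\<lambda>t. \<bar>F t\<bar>)"
      using large by (intro integral_le sub) auto
    also have "\<dots> \<le> J" unfolding J_def by (intro integral_subset_le sub int) auto
    finally have "e * k \<le> J" .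
    moreover have "e * k = J + e" using \<open>e > 0\<close> by (simp add: k_def field_simps)
    ultimately show False using \<open>e > 0\<close> by simp
  qed
  ultimately show ?thesis by (rule that)
qed

text \<open>Over an interval \<open>[a, b]\<close> the integral is \<open>F b - F a\<close>; arbitrarily far out there are end points at
  which \<open>F\<close> is small.\<close>

lemma integral_derivative_eq_0:
  fixes F F' :: "real \<Rightarrow> real"
  assumes deriv: "\<And>t. (F has_real_derivative F' t) (at t)"
    and F: "F absolutely_integrable_on UNIV" and F': "F' absolutely_integrable_on UNIV"
  shows "integral UNIV F' = 0"
proof (rule ccontr)
  define I where "I = integral UNIV F'"
  assume "integral UNIV F' \<noteq> 0"
  then have I: "\<bar>I\<bar> / 4 > 0" by (simp add: I_def)
  have "(F' has_integral I) UNIV"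
    unfolding I_def using F' set_lebesgue_integral_eq_integral(1) by blast
  then have "\<forall>e>0. \<exists>B>0. \<forall>a b. ball 0 B \<subseteq> cbox a b \<longrightarrow> norm (integral (cbox a b) F' - I) < e"
    unfolding has_integral_alt'[of F' I UNIV] by simp
  with I obtain B where B: "B > 0"
      "\<And>a b. ball 0 B \<subseteq> cbox a b \<Longrightarrow> norm (integral (cbox a b) F' - I) < \<bar>I\<bar> / 4"
    by meson
  obtain k where k: "k > 0" "\<And>c. \<exists>t\<in>{c..c + k}. \<bar>F t\<bar> < \<bar>I\<bar> / 4"
    using integrable_takes_small_values[OF F I] by blast
  obtain b where b: "b \<in> {B..B + k}" "\<bar>F b\<bar> < \<bar>I\<bar> / 4" using k(2)[of B] by blast
  obtain a where a: "a \<in> {- B - k..- B - k + k}" "\<bar>F a\<bar> < \<bar>I\<bar> / 4" using k(2)[of "- B - k"] by blast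
  have "(F' has_integral (F b - F a)) {a..b}"
    using a b \<open>B > 0\<close> deriv
    by (intro fundamental_theorem_of_calculus)
      (auto simp: has_real_derivative_iff_has_vector_derivative[symmetric]
        intro: has_field_derivative_at_within)
  moreover have "ball 0 B \<subseteq> cbox a b" using a b by (auto simp: dist_norm)
  ultimately have "\<bar>F b - F a - I\<bar> < \<bar>I\<bar> / 4"
    using B(2)[of a b] by (simp add: integral_unique)
  then show False using a b by linarith
qed

lemma absolutely_integrable_bounded_continuous_mult:
  fixes f g :: "real \<Rightarrow> real"
  assumes "continuous_on UNIV f" "\<And>t. \<bar>f t\<bar> \<le> K" "g absolutely_integrable_on UNIV"
  shows "(\<lambda>t. f t * g t) absolutely_integrable_on UNIV"
proof (rule absolutely_integrable_bounded_measurable_product_real)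
  have "f \<in> borel_measurable lborel" using assms(1) borel_measurable_continuous_onI by simp
  then show "f \<in> borel_measurable (lebesgue_on UNIV)"
    by (simp add: lebesgue_on_UNIV_eq measurable_completion)
qed (use assms in \<open>auto simp: bounded_iff\<close>)

text \<open>Integration by parts over the whole line has no boundary terms.\<close>

lemma integral_trig_parts:
  fixes g g' :: "real \<Rightarrow> real" and r :: real
  assumes deriv: "\<And>t. (g has_real_derivative g' t) (at t)"
    and g: "g absolutely_integrable_on UNIV" and g': "g' absolutely_integrable_on UNIV"
  shows "r * integral UNIV (\<lambda>t. cos (r * t) * g t) = - integral UNIV (\<lambda>t. sin (r * t) * g' t)"
    and "r * integral UNIV (\<lambda>t. sin (r * t) * g t) = integral UNIV (\<lambda>t. cos (r * t) * g' t)"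
proof -
  have abs: "(\<lambda>t. cos (r * t) * h t) absolutely_integrable_on UNIV"
      "(\<lambda>t. sin (r * t) * h t) absolutely_integrable_on UNIV"
    if "h absolutely_integrable_on UNIV" for h
    by (intro absolutely_integrable_bounded_continuous_mult[where K = 1] that;
        auto intro!: continuous_intros)+
  note ints = abs[THEN set_lebesgue_integral_eq_integral(1)]
  have "integral UNIV (\<lambda>t. r * (cos (r * t) * g t) + sin (r * t) * g' t) = 0"
  proof (rule integral_derivative_eq_0[where F = "\<lambda>t. sin (r * t) * g t"])
    show "((\<lambda>t. sin (r * t) * g t) has_real_derivative r * (cos (r * t) * g t) + sin (r * t) * g' t) (at t)" for t
      by (auto intro!: derivative_eq_intros deriv)
  qed (intro abs g g' set_integral_add set_integrable_mult_right)+
  then show "r * integral UNIV (\<lambda>t. cos (r * t) * g t) = - integral UNIV (\<lambda>t. sin (r * t) * g' t)"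
    using ints(1)[OF g] ints(2)[OF g']
    by (subst (asm) Henstock_Kurzweil_Integration.integral_add) (auto intro: integrable_on_mult_right)
  have "integral UNIV (\<lambda>t. cos (r * t) * g' t - r * (sin (r * t) * g t)) = 0"
  proof (rule integral_derivative_eq_0[where F = "\<lambda>t. cos (r * t) * g t"])
    show "((\<lambda>t. cos (r * t) * g t) has_real_derivative cos (r * t) * g' t - r * (sin (r * t) * g t)) (at t)" for t
      by (auto intro!: derivative_eq_intros deriv)
  qed (intro abs g g' set_integral_diff set_integrable_mult_right)+
  then show "r * integral UNIV (\<lambda>t. sin (r * t) * g t) = integral UNIV (\<lambda>t. cos (r * t) * g' t)"
    using ints(2)[OF g] ints(1)[OF g']
    by (subst (asm) Henstock_Kurzweil_Integration.integral_diff) (auto intro: integrable_on_mult_right)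
qed

text \<open>Differentiating \<open>q\<close> interchanges the cosine and the sine integral up to a factor \<open>\<plusminus>r\<close>, so the sum \<open>E\<close>
  of their squares gets the factor \<open>r\<^sup>2\<close> from each derivative.\<close>

lemma smooth_L1_fourier_decay:
  assumes "smooth_L1 N q"
  obtains C where "C \<ge> 0" "\<And>r. r ^ N * \<bar>integral UNIV (\<lambda>t. cos (r * t) * q t)\<bar> \<le> C" 
proof -
  define J where "J = integral UNIV (\<lambda>t. \<bar>(deriv ^^ N) q t\<bar>)"
  have abs: "((deriv ^^ i) q) absolutely_integrable_on UNIV" if "i \<le> N" for i
    using assms that by (auto simp: smooth_L1_def)
  have deriv: "((deriv ^^ i) q has_real_derivative (deriv ^^ Suc i) q t) (at t)" if "i < N" for i t
    using assms that by (auto simp: smooth_L1_def DERIV_deriv_iff_real_differentiable)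
  define E where "E r i = (integral UNIV (\<lambda>t. cos (r * t) * (deriv ^^ i) q t))\<^sup>2
      + (integral UNIV (\<lambda>t. sin (r * t) * (deriv ^^ i) q t))\<^sup>2" for r i
  have E: "E r i = (r ^ i)\<^sup>2 * E r 0" if "i \<le> N" for r i
    using that
  proof (induction i)
    case (Suc i)
    note parts = integral_trig_parts[OF deriv abs abs, of i r]
    have "E r (Suc i) = (r * integral UNIV (\<lambda>t. sin (r * t) * (deriv ^^ i) q t))\<^sup>2
        + (- (r * integral UNIV (\<lambda>t. cos (r * t) * (deriv ^^ i) q t)))\<^sup>2"
      using parts Suc.prems unfolding E_def by (simp del: funpow.simps)
    also have "\<dots> = r\<^sup>2 * E r i"
      unfolding E_def by (simp add: power_mult_distrib algebra_simps)
    finally have "E r (Suc i) = r\<^sup>2 * E r i" .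
    then show ?case using Suc by (simp add: power_mult_distrib)
  qed simp
  have bound: "\<bar>integral UNIV (\<lambda>t. f (r * t) * (deriv ^^ N) q t)\<bar> \<le> J"
    if "continuous_on UNIV f" "\<And>t. \<bar>f t\<bar> \<le> 1" for f r
  proof -
    have "(\<lambda>t. f (r * t) * (deriv ^^ N) q t) absolutely_integrable_on UNIV"
      using that by (intro absolutely_integrable_bounded_continuous_mult[where K = 1] abs
          continuous_on_compose2[OF that(1)]) (auto intro!: continuous_intros)
    then have "norm (integral UNIV (\<lambda>t. f (r * t) * (deriv ^^ N) q t)) \<le> J"
      unfolding J_def using abs[of N] that
      by (intro integral_norm_bound_integral)
        (auto simp: absolutely_integrable_on_def abs_mult mult_left_le_one_le)
    then show ?thesis by simp
  qed
  have "J \<ge> 0" using bound[of "\<lambda>_. 0"] by simp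
  moreover have "r ^ N * \<bar>integral UNIV (\<lambda>t. cos (r * t) * q t)\<bar> \<le> 2 * J" for r
  proof -
    have "(r ^ N * \<bar>integral UNIV (\<lambda>t. cos (r * t) * q t)\<bar>)\<^sup>2 \<le> (r ^ N)\<^sup>2 * E r 0"
      by (simp add: E_def power_mult_distrib mult_left_mono)
    also have "\<dots> = E r N" using E[of N r] by simp
    also have "\<dots> \<le> J\<^sup>2 + J\<^sup>2"
    proof -
      have sq: "x\<^sup>2 \<le> J\<^sup>2" if "\<bar>x\<bar> \<le> J" for x using abs_le_square_iff[of x J] that by simp
      show ?thesis unfolding E_def
        by (intro add_mono sq bound[of cos r] bound[of sin r]) (auto intro!: continuous_intros)
    qed
    also have "\<dots> \<le> (2 * J)\<^sup>2" by (simp add: power_mult_distrib)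
    finally show ?thesis by (rule power2_le_imp_le) (use \<open>J \<ge> 0\<close> in simp)
  qed
  ultimately show ?thesis using that[of "2 * J"] by simp
qed

lemma integral_half_line_even:
  fixes h :: "real \<Rightarrow> real"
  assumes even: "\<And>t. h (- t) = h t" and h: "h absolutely_integrable_on UNIV"
  shows "integral UNIV h = 2 * integral {0..} h"
proof -
  have abs: "h absolutely_integrable_on {0..}" "h absolutely_integrable_on {..0}"
    using h by (auto intro: set_integrable_subset)
  have "integral {..0} (\<lambda>t. h (- t)) = integral {0..} h"
    using has_absolute_integral_reflect_real[of "{..0}" "{0..}" h "integral {0..} h"] abs by auto
  moreover have "integral ({..0} \<union> {0..}) h = integral {..0} h + integral {0..} h"
    using abs[THEN set_lebesgue_integral_eq_integral(1)]
    by (intro integral_Un) (auto intro: negligible_subset[of "{0}"])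
  moreover have "{..0} \<union> {0..} = (UNIV :: real set)" by auto
  ultimately show ?thesis by (simp add: even)
qed

lemma qtilde_decay:
  assumes "smooth_L1 (2 * N) q" "\<And>t. q (- t) = q t"
  obtains C where "C \<ge> 0" "\<And>s. s \<ge> 0 \<Longrightarrow> s ^ N * \<bar>qtilde q s\<bar> \<le> C"
proof -
  obtain C where C: "C \<ge> 0" "\<And>r. r ^ (2 * N) * \<bar>integral UNIV (\<lambda>t. cos (r * t) * q t)\<bar> \<le> C"
    using smooth_L1_fourier_decay[OF assms(1)] by blast
  have q: "q absolutely_integrable_on UNIV" using assms(1) by (auto simp: smooth_L1_def dest: spec[of _ 0])
  have "qtilde q s = integral UNIV (\<lambda>t. cos (sqrt s * t) * q t)" for s
  proof -
    have "(\<lambda>t. cos (sqrt s * t) * q t) absolutely_integrable_on UNIV"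
      by (intro absolutely_integrable_bounded_continuous_mult[where K = 1] q) (auto intro!: continuous_intros)
    then have "integral UNIV (\<lambda>t. cos (sqrt s * t) * q t) = 2 * integral {0..} (\<lambda>t. cos (sqrt s * t) * q t)"
      using assms(2) by (intro integral_half_line_even) auto
    also have "\<dots> = qtilde q s"
      unfolding qtilde_def integral_mult_right[symmetric]
      by (intro integral_cong) (simp add: mult.commute mult.left_commute)
    finally show ?thesis ..
  qed
  moreover have "sqrt s ^ (2 * N) = s ^ N" if "s \<ge> 0" for s
    using that by (simp add: power_mult)
  ultimately have "s ^ N * \<bar>qtilde q s\<bar> \<le> C" if "s \<ge> 0" for s using C(2)[of "sqrt s"] that by simp
  then show ?thesis using that[OF C(1)] by blast
qed


section \<open>Eigenfunction expansions\<close>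

lemma function_series:
  fixes \<phi> :: "nat \<Rightarrow> real \<Rightarrow> real"
  assumes cont: "\<And>l. continuous_on {a..b} (\<phi> l)"
    and bound: "\<And>l x. x \<in> {a..b} \<Longrightarrow> \<bar>\<phi> l x\<bar> \<le> B l" and B: "summable B"
  shows "uniform_limit {a..b} (\<lambda>n x. \<Sum>l<n. \<phi> l x) (\<lambda>x. \<Sum>l. \<phi> l x) sequentially"
    and "continuous_on {a..b} (\<lambda>x. \<Sum>l. \<phi> l x)"
    and "(\<lambda>l. integral {a..b} (\<phi> l)) sums integral {a..b} (\<lambda>x. \<Sum>l. \<phi> l x)"
proof -
  show u: "uniform_limit {a..b} (\<lambda>n x. \<Sum>l<n. \<phi> l x) (\<lambda>x. \<Sum>l. \<phi> l x) sequentially"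
    by (rule Weierstrass_m_test[OF _ B]) (use bound in auto)
  have c: "continuous_on {a..b} (\<lambda>x. \<Sum>l<n. \<phi> l x)" for n by (intro continuous_intros cont)
  show "continuous_on {a..b} (\<lambda>x. \<Sum>l. \<phi> l x)"
    by (rule uniform_limit_theorem[OF _ u]) (use c in auto)
  obtain I J where IJ: "\<And>n. ((\<lambda>x. \<Sum>l<n. \<phi> l x) has_integral I n) {a..b}"
      "((\<lambda>x. \<Sum>l. \<phi> l x) has_integral J) {a..b}" "I \<longlonglongrightarrow> J"
    by (rule uniform_limit_integral[OF u c]) auto
  have "I = (\<lambda>n. \<Sum>l<n. integral {a..b} (\<phi> l))"
    unfolding integral_unique[OF IJ(1), symmetric]
    by (intro ext integral_sum integrable_continuous_real cont) auto
  then show "(\<lambda>l. integral {a..b} (\<phi> l)) sums integral {a..b} (\<lambda>x. \<Sum>l. \<phi> l x)"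
    using IJ(2,3) by (simp add: sums_def integral_unique)
qed

lemma continuous_on_Icc_bounded:
  fixes g :: "real \<Rightarrow> real"
  assumes "continuous_on {a..b} g"
  obtains G where "\<And>x. x \<in> {a..b} \<Longrightarrow> \<bar>g x\<bar> \<le> G"
proof -
  have "bounded (g ` {a..b})"
    by (rule compact_imp_bounded[OF compact_continuous_image[OF assms compact_Icc]])
  then obtain G where "\<forall>x\<in>{a..b}. \<bar>g x\<bar> \<le> G" by (auto simp: bounded_iff)
  then show ?thesis by (intro that) (rule bspec)
qed

lemma function_series_mult:
  fixes \<phi> :: "nat \<Rightarrow> real \<Rightarrow> real"
  assumes cont: "\<And>l. continuous_on {a..b} (\<phi> l)"
    and bound: "\<And>l x. x \<in> {a..b} \<Longrightarrow> \<bar>\<phi> l x\<bar> \<le> B l" and B: "summable B"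
    and g: "continuous_on {a..b} g"
  shows "(\<lambda>l. integral {a..b} (\<lambda>x. \<phi> l x * g x)) sums integral {a..b} (\<lambda>x. (\<Sum>l. \<phi> l x) * g x)"
proof -
  obtain G where G: "\<And>x. x \<in> {a..b} \<Longrightarrow> \<bar>g x\<bar> \<le> G"
    by (rule continuous_on_Icc_bounded[OF g]) (rule that)
  have "(\<lambda>l. integral {a..b} (\<lambda>x. \<phi> l x * g x)) sums integral {a..b} (\<lambda>x. \<Sum>l. \<phi> l x * g x)"
  proof (rule function_series(3)[where B = "\<lambda>l. B l * G"])
    show "\<bar>\<phi> l x * g x\<bar> \<le> B l * G" if "x \<in> {a..b}" for l x
    proof -
      have "\<bar>\<phi> l x\<bar> * \<bar>g x\<bar> \<le> B l * G"
        using bound[OF that, of l] G[OF that] by (intro mult_mono) auto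
      then show ?thesis by (simp add: abs_mult)
    qed
  qed (intro continuous_intros cont g summable_mult2 B)+
  moreover have "(\<Sum>l. \<phi> l x * g x) = (\<Sum>l. \<phi> l x) * g x" if "x \<in> {a..b}" for x
  proof -
    have "summable (\<lambda>l. \<phi> l x)"
      by (rule summable_comparison_test'[OF B, of 0]) (use bound that in auto)
    then show ?thesis by (rule suminf_mult2[symmetric])
  qed
  ultimately show ?thesis using integral_cong[of "{a..b}"] by (metis (no_types, lifting))
qed

text \<open>The assumption \<open>zd_deriv\<close> is the eigenvalue equation, solved for the second derivative.\<close>

locale eigenfunctions =
  fixes v :: "real \<Rightarrow> real" and xm :: real and lam :: "nat \<Rightarrow> real" and z zd :: "nat \<Rightarrow> real \<Rightarrow> real"
  assumes xm: "xm > 0" and cont_v: "continuous_on {0..xm} v"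
    and v_pos: "x \<in> {0..xm} \<Longrightarrow> v x > 0"
    and z_deriv: "x \<in> {0..xm} \<Longrightarrow> (z l has_real_derivative zd l x) (at x within {0..xm})"
    and zd_deriv: "x \<in> {0..xm} \<Longrightarrow>
      (zd l has_real_derivative - (lam l * z l x) / (v x)\<^sup>2) (at x within {0..xm})"
    and zd_0: "zd l 0 = 0" and z_xm: "z l xm = 0"
    and orthonormal: "ip v xm (z l) (z k) = (if l = k then 1 else 0)"
begin

abbreviation "\<rho> x \<equiv> 1 / (v x)\<^sup>2"

lemma cont_\<rho>: "continuous_on {0..xm} \<rho>"
  using v_pos by (intro continuous_intros cont_v) (metis less_irrefl power_eq_0_iff)

lemma \<rho>_pos: "x \<in> {0..xm} \<Longrightarrow> \<rho> x > 0"
  using v_pos[of x] by simp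

lemma cont_z: "continuous_on {0..xm} (z l)"
  by (rule DERIV_continuous_on[OF z_deriv])

lemma cont_zd: "continuous_on {0..xm} (zd l)"
  by (rule DERIV_continuous_on[OF zd_deriv])

lemma ip_eq: "ip v xm f g = integral {0..xm} (\<lambda>x. f x * (g x * \<rho> x))"
  by (simp add: ip_def weighted_ip_def mult.assoc)

lemma ip_cong:
  assumes "\<And>x. x \<in> {0..xm} \<Longrightarrow> f x = f' x" "\<And>x. x \<in> {0..xm} \<Longrightarrow> g x = g' x"
  shows "ip v xm f g = ip v xm f' g'"
  unfolding ip_eq by (intro integral_cong) (use assms in simp)

text \<open>Integration by parts moves one derivative to the other factor and produces \<open>lam l\<close> times the inner
  product of the eigenfunctions; the two boundary conditions cancel the boundary terms.\<close>

lemma zd_orthogonal: "integral {0..xm} (\<lambda>x. zd l x * zd k x) = (if l = k then lam l else 0)"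
proof -
  have "((\<lambda>x. zd l x * zd k x - lam l * (z l x * (z k x * \<rho> x))) has_integral
      (zd l xm * z k xm - zd l 0 * z k 0)) {0..xm}"
    using xm by (intro fundamental_theorem_of_calculus)
      (auto simp: has_real_derivative_iff_has_vector_derivative[symmetric]
        intro!: derivative_eq_intros z_deriv zd_deriv)
  then have "integral {0..xm} (\<lambda>x. zd l x * zd k x - lam l * (z l x * (z k x * \<rho> x))) = 0"
    by (simp add: integral_unique z_xm zd_0)
  moreover have "(\<lambda>x. zd l x * zd k x) integrable_on {0..xm}"
    "(\<lambda>x. lam l * (z l x * (z k x * \<rho> x))) integrable_on {0..xm}"
    by (intro integrable_continuous_real continuous_on_mult continuous_on_const cont_z cont_zd cont_\<rho>)+
  ultimately have "integral {0..xm} (\<lambda>x. zd l x * zd k x) =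
      integral {0..xm} (\<lambda>x. lam l * (z l x * (z k x * \<rho> x)))"
    by (simp only: Henstock_Kurzweil_Integration.integral_diff right_minus_eq)
  also have "\<dots> = lam l * ip v xm (z l) (z k)" by (simp only: ip_eq integral_mult_right)
  finally have "integral {0..xm} (\<lambda>x. zd l x * zd k x) = lam l * ip v xm (z l) (z k)" .
  then show ?thesis by (simp add: orthonormal)
qed

text \<open>The eigenvalue is the squared norm of \<open>zd l\<close>. If it were zero, \<open>z l\<close> would be constant, and zero by
  the condition at \<open>xm\<close>.\<close>

lemma lam_pos: "lam l > 0"
proof (rule ccontr)
  assume "\<not> lam l > 0"
  moreover have "integral {0..xm} (\<lambda>x. zd l x * zd l x) \<ge> 0"
    by (intro integral_nonneg integrable_continuous_real continuous_intros cont_zd) simp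
  ultimately have "integral {0..xm} (\<lambda>x. zd l x * zd l x) = 0" by (simp add: zd_orthogonal)
  then have "\<forall>x\<in>{0..xm}. zd l x * zd l x = 0"
    using xm by (subst (asm) integral_eq_0_iff) (auto intro: continuous_on_mult cont_zd)
  then have "\<forall>x\<in>{0..xm}. (z l has_real_derivative 0) (at x within {0..xm})"
    using z_deriv[of _ l] by (metis mult_eq_0_iff)
  then obtain c where "\<forall>x\<in>{0..xm}. z l x = c"
    using has_field_derivative_zero_constant[of "{0..xm}" "z l"] by auto
  then have "\<forall>x\<in>{0..xm}. z l x = 0" using z_xm[of l] xm by auto
  then have "ip v xm (z l) (z l) = ip v xm (\<lambda>_. 0) (\<lambda>_. 0)" by (intro ip_cong) auto
  then show False unfolding orthonormal by (simp add: ip_eq)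
qed

text \<open>This is Bessel's inequality for the orthogonal system of the derivatives and the indicator function
  of \<open>[x, xm]\<close>, whose inner product with \<open>zd l\<close> is \<open>- z l x\<close>.\<close>

lemma bessel:
  assumes "x \<in> {0..xm}"
  shows "(\<Sum>l<L. (z l x)\<^sup>2 / lam l) \<le> xm - x"
proof -
  define Q where "Q = (\<Sum>l<L. (z l x)\<^sup>2 / lam l)"
  define a where "a l = - z l x / lam l" for l
  define F where "F t = (\<Sum>l<L. a l * zd l t)" for t
  have contF: "continuous_on {0..xm} F" unfolding F_def by (intro continuous_intros cont_zd)
  have contFx: "continuous_on {x..xm} F" by (rule continuous_on_subset[OF contF]) (use assms in auto)
  have "integral {0..xm} (\<lambda>t. F t * F t) = (\<Sum>l<L. \<Sum>k<L. a l * a k * integral {0..xm} (\<lambda>t. zd l t * zd k t))"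
  proof -
    have "integral {0..xm} (\<lambda>t. F t * F t) =
        integral {0..xm} (\<lambda>t. \<Sum>l<L. \<Sum>k<L. a l * a k * (zd l t * zd k t))"
      by (rule integral_cong) (simp add: F_def sum_product algebra_simps)
    also have "\<dots> = (\<Sum>l<L. \<Sum>k<L. integral {0..xm} (\<lambda>t. a l * a k * (zd l t * zd k t)))"
      by (subst integral_sum; (intro sum.cong refl, subst integral_sum)?)
        (auto intro!: integrable_continuous_real continuous_intros cont_zd)
    finally show ?thesis by simp
  qed
  also have "\<dots> = (\<Sum>l<L. a l * a l * lam l)"
    by (simp add: zd_orthogonal if_distrib if_distribR sum.delta cong: if_cong)
  also have "\<dots> = Q" unfolding Q_def a_def
    using lam_pos by (intro sum.cong) (auto simp: power2_eq_square less_imp_neq[symmetric])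
  finally have FF: "integral {0..xm} (\<lambda>t. F t * F t) = Q" .
  have "(F has_integral ((\<Sum>l<L. a l * z l xm) - (\<Sum>l<L. a l * z l x))) {x..xm}"
    unfolding F_def using assms
    by (intro fundamental_theorem_of_calculus)
      (auto simp: has_real_derivative_iff_has_vector_derivative[symmetric]
        intro!: DERIV_sum derivative_eq_intros DERIV_subset[OF z_deriv])
  then have F1: "integral {x..xm} F = Q"
    by (simp add: integral_unique z_xm a_def Q_def sum_negf[symmetric] power2_eq_square)
  have int: "(\<lambda>t. F t * F t) integrable_on {x..xm}" "F integrable_on {x..xm}"
    by (intro integrable_continuous_real continuous_intros contFx)+
  have "0 \<le> integral {x..xm} (\<lambda>t. (1 - F t)\<^sup>2)"
    by (intro integral_nonneg integrable_continuous_real continuous_intros contFx) simp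
  also have "\<dots> = integral {x..xm} (\<lambda>t. 1 - 2 * F t + F t * F t)"
    by (intro integral_cong) (simp add: power2_eq_square algebra_simps)
  also have "\<dots> = (xm - x) - 2 * Q + integral {x..xm} (\<lambda>t. F t * F t)"
  proof -
    have int2: "(\<lambda>t. 2 * F t) integrable_on {x..xm}" "(\<lambda>t. 1 - 2 * F t) integrable_on {x..xm}"
      by (intro integrable_continuous_real continuous_intros contFx)+
    have "integral {x..xm} (\<lambda>t. 1 - 2 * F t) = (xm - x) - 2 * Q"
      using assms F1 int2(1) by (subst Henstock_Kurzweil_Integration.integral_diff) auto
    then show ?thesis using int int2 by (subst Henstock_Kurzweil_Integration.integral_add) auto
  qed
  also have "integral {x..xm} (\<lambda>t. F t * F t) \<le> Q"
    unfolding FF[symmetric] using assms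
    by (intro integral_subset_le int integrable_continuous_real continuous_intros contF) auto
  finally show ?thesis by (simp add: Q_def)
qed

text \<open>Integrating Bessel's inequality over \<open>x\<close> with the weight \<open>\<rho>\<close> turns each \<open>(z l x)\<^sup>2\<close> into \<open>1\<close>.\<close>

lemma summable_inverse_lam: "summable (\<lambda>l. 1 / lam l)"
proof (rule summableI_nonneg_bounded)
  show "0 \<le> 1 / lam l" for l using lam_pos[of l] by simp
  show "(\<Sum>l<L. 1 / lam l) \<le> integral {0..xm} (\<lambda>x. xm * \<rho> x)" for L
  proof -
    have "(\<Sum>l<L. 1 / lam l) = (\<Sum>l<L. integral {0..xm} (\<lambda>x. 1 / lam l * (z l x * (z l x * \<rho> x))))"
      by (simp only: integral_mult_right ip_eq[symmetric] orthonormal) simp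
    also have "\<dots> = integral {0..xm} (\<lambda>x. \<Sum>l<L. 1 / lam l * (z l x * (z l x * \<rho> x)))"
      by (intro integral_sum[symmetric] integrable_continuous_real continuous_on_mult
          continuous_on_const cont_z cont_\<rho>) auto
    also have "\<dots> \<le> integral {0..xm} (\<lambda>x. xm * \<rho> x)"
    proof (intro integral_le integrable_continuous_real continuous_on_sum continuous_on_mult
        continuous_on_const cont_z cont_\<rho>)
      fix x assume x: "x \<in> {0..xm}"
      have "(\<Sum>l<L. 1 / lam l * (z l x * (z l x * \<rho> x))) = (\<Sum>l<L. (z l x)\<^sup>2 / lam l) * \<rho> x"
        unfolding sum_distrib_right by (intro sum.cong) (auto simp: power2_eq_square)
      also have "\<dots> \<le> xm * \<rho> x"
        using bessel[OF x, of L] x \<rho>_pos[OF x] by (intro mult_right_mono) auto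
      finally show "(\<Sum>l<L. 1 / lam l * (z l x * (z l x * \<rho> x))) \<le> xm * \<rho> x" .
    qed
    finally show ?thesis .
  qed
qed

lemma inverse_lam_bounded: obtains C where "C > 0" "\<And>l. 1 / lam l \<le> C"
proof -
  have nn: "0 \<le> 1 / lam l" for l using lam_pos[of l] by simp
  have "1 / lam l \<le> (\<Sum>l. 1 / lam l) + 1" for l
    using sum_le_suminf[OF summable_inverse_lam, of "{l}"] nn by simp
  moreover have "(\<Sum>l. 1 / lam l) + 1 > 0"
    using suminf_nonneg[OF summable_inverse_lam nn] by simp
  ultimately show ?thesis by (rule that[rotated])
qed

text \<open>A single term of Bessel's inequality bounds \<open>z l\<close>; the eigenvalue equation, integrated from \<open>0\<close>,
  bounds \<open>zd l\<close>.\<close>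

lemma eigenfunction_bounds:
  obtains K where "K \<ge> 0" "\<And>l x. x \<in> {0..xm} \<Longrightarrow> \<bar>z l x\<bar> \<le> K * lam l"
    "\<And>l x. x \<in> {0..xm} \<Longrightarrow> \<bar>zd l x\<bar> \<le> K * lam l"
proof -
  obtain C where C: "C > 0" "\<And>l. 1 / lam l \<le> C" using inverse_lam_bounded by blast
  have z: "\<bar>z l x\<bar> \<le> sqrt (xm * C) * lam l" if x: "x \<in> {0..xm}" for l x
  proof -
    have "(z l x)\<^sup>2 / lam l \<le> (\<Sum>k<Suc l. (z k x)\<^sup>2 / lam k)"
      using member_le_sum[of l "{..<Suc l}" "\<lambda>k. (z k x)\<^sup>2 / lam k"] lam_pos
      by (auto simp: less_imp_le)
    also have "\<dots> \<le> xm" using bessel[OF x, of "Suc l"] x by auto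
    finally have "(z l x)\<^sup>2 \<le> xm * lam l" using lam_pos[of l] by (simp add: field_simps)
    also have "\<dots> \<le> xm * (C * lam l * lam l)"
      using C(2)[of l] lam_pos[of l] xm by (intro mult_left_mono) (auto simp: field_simps)
    also have "\<dots> = (sqrt (xm * C) * lam l)\<^sup>2"
      using C xm by (simp add: power_mult_distrib power2_eq_square)
    finally have "\<bar>z l x\<bar> \<le> \<bar>sqrt (xm * C) * lam l\<bar>" by (simp only: abs_le_square_iff)
    then show ?thesis using C(1) xm lam_pos[of l] by (simp add: abs_mult)
  qed
  define K where "K = integral {0..xm} (\<lambda>x. \<rho> x) + 1"
  \<comment> \<open>A majorant of the second derivative, from \<open>\<bar>z\<bar> \<le> 1 + z\<^sup>2\<close>; normalization makes its integral a fixed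
    multiple of \<open>lam l\<close>.\<close>
  define g where "g l t = lam l * (\<rho> t + z l t * (z l t * \<rho> t))" for l t
  have contg: "continuous_on {0..xm} (g l)" for l
    unfolding g_def
    by (intro continuous_on_mult continuous_on_add continuous_on_const cont_\<rho> cont_z)
  have g: "0 \<le> g l t" "\<bar>- (lam l * z l t) / (v t)\<^sup>2\<bar> \<le> g l t" for l t
  proof -
    have "\<bar>z l t\<bar> \<le> 1 + z l t * z l t"
      using zero_le_square[of "\<bar>z l t\<bar> - 1"] by (simp add: algebra_simps)
    then have "lam l * \<rho> t * \<bar>z l t\<bar> \<le> lam l * \<rho> t * (1 + z l t * z l t)"
      using lam_pos[of l] by (intro mult_left_mono) auto
    then show "\<bar>- (lam l * z l t) / (v t)\<^sup>2\<bar> \<le> g l t"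
      using lam_pos[of l] by (simp add: g_def abs_mult distrib_left)
    then show "0 \<le> g l t" by (rule order_trans[rotated]) simp
  qed
  have int_g: "integral {0..xm} (g l) = K * lam l" for l
  proof -
    have int: "(\<lambda>x. \<rho> x) integrable_on {0..xm}" "(\<lambda>x. z l x * (z l x * \<rho> x)) integrable_on {0..xm}"
      by (intro integrable_continuous_real continuous_on_mult cont_\<rho> cont_z)+
    have "integral {0..xm} (g l) = lam l * (integral {0..xm} (\<lambda>x. \<rho> x) + ip v xm (z l) (z l))"
      unfolding g_def ip_eq integral_mult_right
        Henstock_Kurzweil_Integration.integral_add[OF int] ..
    then show ?thesis by (simp add: K_def orthonormal)
  qed
  have zd: "\<bar>zd l x\<bar> \<le> K * lam l" if x: "x \<in> {0..xm}" for l x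
  proof -
    have "((\<lambda>t. - (lam l * z l t) / (v t)\<^sup>2) has_integral (zd l x - zd l 0)) {0..x}"
    proof (rule fundamental_theorem_of_calculus)
      fix t assume t: "t \<in> {0..x}"
      have "(zd l has_real_derivative - (lam l * z l t) / (v t)\<^sup>2) (at t within {0..x})"
        by (rule DERIV_subset[OF zd_deriv]) (use t x in auto)
      then show "(zd l has_vector_derivative - (lam l * z l t) / (v t)\<^sup>2) (at t within {0..x})"
        by (simp only: has_real_derivative_iff_has_vector_derivative)
    qed (use x in simp)
    then have int: "(\<lambda>t. - (lam l * z l t) / (v t)\<^sup>2) integrable_on {0..x}"
        "zd l x = integral {0..x} (\<lambda>t. - (lam l * z l t) / (v t)\<^sup>2)"
      by (auto simp only: zd_0 diff_zero has_integral_iff)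
    have int_gx: "g l integrable_on {0..x}" "g l integrable_on {0..xm}"
      using x by (auto intro!: integrable_continuous_real continuous_on_subset[OF contg])
    have "\<bar>zd l x\<bar> \<le> integral {0..x} (g l)"
      unfolding int(2) real_norm_def[symmetric]
      by (rule integral_norm_bound_integral[OF int(1) int_gx(1)]) (use g in simp)
    also have "\<dots> \<le> integral {0..xm} (g l)"
      by (rule integral_subset_le[OF _ int_gx]) (use x g in auto)
    finally show ?thesis by (simp only: int_g)
  qed
  show ?thesis
  proof (rule that[of "max K (sqrt (xm * C))"])
    show "\<bar>z l x\<bar> \<le> max K (sqrt (xm * C)) * lam l" if "x \<in> {0..xm}" for l x
      by (rule order_trans[OF z[OF that]]) (use lam_pos[of l] in \<open>auto intro!: mult_right_mono\<close>)
    show "\<bar>zd l x\<bar> \<le> max K (sqrt (xm * C)) * lam l" if "x \<in> {0..xm}" for l x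
      by (rule order_trans[OF zd[OF that]]) (use lam_pos[of l] in \<open>auto intro!: mult_right_mono\<close>)
  qed (use xm C in \<open>auto simp: le_max_iff_disj\<close>)
qed



text \<open>Since \<open>z l\<close> and \<open>zd l\<close> are bounded by a multiple of \<open>lam l\<close>, this makes both series below converge
  absolutely and uniformly.\<close>

definition tame :: "(nat \<Rightarrow> real) \<Rightarrow> bool" where
  "tame d \<longleftrightarrow> summable (\<lambda>l. \<bar>d l\<bar> * lam l)"

definition eigen_sum :: "(nat \<Rightarrow> real) \<Rightarrow> real \<Rightarrow> real" where "eigen_sum d x = (\<Sum>l. d l * z l x)"

definition deriv_sum :: "(nat \<Rightarrow> real) \<Rightarrow> real \<Rightarrow> real" where "deriv_sum d x = (\<Sum>l. d l * zd l x)"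

lemma tame_mult_bounded:
  assumes "tame d" "\<And>l. \<bar>h l\<bar> \<le> H"
  shows "tame (\<lambda>l. h l * d l)"
  unfolding tame_def
proof (rule summable_comparison_test'[of "\<lambda>l. H * (\<bar>d l\<bar> * lam l)" 0])
  show "summable (\<lambda>l. H * (\<bar>d l\<bar> * lam l))" using assms(1) by (auto simp: tame_def intro: summable_mult)
  show "norm (\<bar>h l * d l\<bar> * lam l) \<le> H * (\<bar>d l\<bar> * lam l)" for l
    using mult_right_mono[OF assms(2)[of l], of "\<bar>d l\<bar> * lam l"] lam_pos[of l]
    by (simp add: abs_mult mult.assoc)
qed

lemma tame_cmult: "tame d \<Longrightarrow> tame (\<lambda>l. c * d l)"
  by (rule tame_mult_bounded[of d "\<lambda>_. c" "\<bar>c\<bar>"]) auto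

lemma tame_if_lam_mult:
  assumes "tame (\<lambda>l. lam l * d l)"
  shows "tame d"
proof -
  obtain C where C: "C > 0" "\<And>l. 1 / lam l \<le> C" using inverse_lam_bounded by blast
  have "tame (\<lambda>l. 1 / lam l * (lam l * d l))"
    by (rule tame_mult_bounded[OF assms, of _ C]) (use C lam_pos in \<open>auto simp: less_imp_le\<close>)
  moreover have "1 / lam l * (lam l * d l) = d l" for l using lam_pos[of l] by simp
  ultimately show ?thesis by simp
qed

lemma tame_bounds:
  assumes "tame d"
  obtains B where "summable B" "\<And>l x. x \<in> {0..xm} \<Longrightarrow> \<bar>d l * z l x\<bar> \<le> B l"
    "\<And>l x. x \<in> {0..xm} \<Longrightarrow> \<bar>d l * zd l x\<bar> \<le> B l"
proof -
  obtain K where K: "K \<ge> 0" "\<And>l x. x \<in> {0..xm} \<Longrightarrow> \<bar>z l x\<bar> \<le> K * lam l"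
    "\<And>l x. x \<in> {0..xm} \<Longrightarrow> \<bar>zd l x\<bar> \<le> K * lam l" using eigenfunction_bounds by blast
  have *: "\<bar>d l * y\<bar> \<le> K * (\<bar>d l\<bar> * lam l)" if "\<bar>y\<bar> \<le> K * lam l" for l y
    using mult_left_mono[OF that, of "\<bar>d l\<bar>"] by (simp add: abs_mult mult.left_commute)
  show ?thesis
    by (rule that[of "\<lambda>l. K * (\<bar>d l\<bar> * lam l)"])
      (use assms K(2,3) * in \<open>auto simp: tame_def intro: summable_mult\<close>)
qed

lemma summable_expansion:
  assumes "tame d" "x \<in> {0..xm}"
  shows "summable (\<lambda>l. d l * z l x)" "summable (\<lambda>l. d l * zd l x)"
proof -
  obtain B where "summable B" "\<And>l x. x \<in> {0..xm} \<Longrightarrow> \<bar>d l * z l x\<bar> \<le> B l"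
    "\<And>l x. x \<in> {0..xm} \<Longrightarrow> \<bar>d l * zd l x\<bar> \<le> B l" by (rule tame_bounds[OF assms(1)]) (rule that)
  then show "summable (\<lambda>l. d l * z l x)" "summable (\<lambda>l. d l * zd l x)"
    using assms(2) by (auto intro!: summable_comparison_test'[of B 0])
qed

lemma expansion_linear:
  assumes "tame d" "tame e" "x \<in> {0..xm}"
  shows "eigen_sum (\<lambda>l. d l + c * e l) x = eigen_sum d x + c * eigen_sum e x"
    and "deriv_sum (\<lambda>l. d l + c * e l) x = deriv_sum d x + c * deriv_sum e x"
proof -
  note s = summable_expansion[OF assms(1,3)] summable_mult[OF summable_expansion(1)[OF assms(2,3)], of c]
    summable_mult[OF summable_expansion(2)[OF assms(2,3)], of c]
  show "eigen_sum (\<lambda>l. d l + c * e l) x = eigen_sum d x + c * eigen_sum e x"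
    unfolding eigen_sum_def suminf_mult[OF summable_expansion(1)[OF assms(2,3)], symmetric]
      suminf_add[OF s(1,3)] by (simp add: algebra_simps)
  show "deriv_sum (\<lambda>l. d l + c * e l) x = deriv_sum d x + c * deriv_sum e x"
    unfolding deriv_sum_def suminf_mult[OF summable_expansion(2)[OF assms(2,3)], symmetric]
      suminf_add[OF s(2,4)] by (simp add: algebra_simps)
qed

lemma cont_eigen_sum:
  assumes "tame d"
  shows "continuous_on {0..xm} (eigen_sum d)"
proof -
  obtain B where B: "summable B" "\<And>l x. x \<in> {0..xm} \<Longrightarrow> \<bar>d l * z l x\<bar> \<le> B l"
      "\<And>l x. x \<in> {0..xm} \<Longrightarrow> \<bar>d l * zd l x\<bar> \<le> B l"
    by (rule tame_bounds[OF assms]) (rule that)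
  show ?thesis unfolding eigen_sum_def
    by (rule function_series(2)[OF _ B(2,1)]) (intro continuous_on_mult continuous_on_const cont_z)
qed

lemma cont_deriv_sum:
  assumes "tame d"
  shows "continuous_on {0..xm} (deriv_sum d)"
proof -
  obtain B where B: "summable B" "\<And>l x. x \<in> {0..xm} \<Longrightarrow> \<bar>d l * z l x\<bar> \<le> B l"
      "\<And>l x. x \<in> {0..xm} \<Longrightarrow> \<bar>d l * zd l x\<bar> \<le> B l"
    by (rule tame_bounds[OF assms]) (rule that)
  show ?thesis unfolding deriv_sum_def
    by (rule function_series(2)[OF _ B(3,1)]) (intro continuous_on_mult continuous_on_const cont_zd)
qed

lemma series_deriv:
  fixes \<phi> \<psi> :: "nat \<Rightarrow> real \<Rightarrow> real"
  assumes deriv: "\<And>l x. x \<in> {0..xm} \<Longrightarrow> (\<phi> l has_real_derivative \<psi> l x) (at x within {0..xm})"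
    and cont: "\<And>l. continuous_on {0..xm} (\<psi> l)"
    and "\<And>l x. x \<in> {0..xm} \<Longrightarrow> \<bar>\<psi> l x\<bar> \<le> B l" "summable B"
    and "\<And>x. x \<in> {0..xm} \<Longrightarrow> summable (\<lambda>l. \<phi> l x)" and x: "x \<in> {0..xm}"
  shows "((\<lambda>x. \<Sum>l. \<phi> l x) has_real_derivative (\<Sum>l. \<psi> l x)) (at x within {0..xm})"
proof -
  have "uniform_limit {0..xm} (\<lambda>n x. \<Sum>l<n. \<psi> l x) (\<lambda>x. \<Sum>l. \<psi> l x) sequentially"
    using function_series(1)[of 0 xm \<psi> B] assms by blast
  from has_field_derivative_series[OF convex_real_interval(5) deriv this x assms(5)[OF x]]
  obtain g where g: "\<And>x. x \<in> {0..xm} \<Longrightarrow> (\<lambda>l. \<phi> l x) sums g x"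
      "\<And>x. x \<in> {0..xm} \<Longrightarrow> (g has_real_derivative (\<Sum>l. \<psi> l x)) (at x within {0..xm})"
    by blast
  show ?thesis
    by (rule has_field_derivative_transform_within[where d = 1, OF g(2)[OF x] _ x])
      (use g(1) in \<open>auto simp: sums_iff\<close>)
qed

lemma eigen_sum_deriv:
  assumes "tame d" "x \<in> {0..xm}"
  shows "(eigen_sum d has_real_derivative deriv_sum d x) (at x within {0..xm})"
proof -
  obtain B where B: "summable B" "\<And>l x. x \<in> {0..xm} \<Longrightarrow> \<bar>d l * z l x\<bar> \<le> B l"
      "\<And>l x. x \<in> {0..xm} \<Longrightarrow> \<bar>d l * zd l x\<bar> \<le> B l"
    by (rule tame_bounds[OF assms(1)]) (rule that)
  show ?thesis unfolding eigen_sum_def deriv_sum_def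
    by (rule series_deriv[OF _ _ B(3,1) _ assms(2)])
      (auto intro!: DERIV_cmult z_deriv continuous_on_mult cont_zd summable_expansion assms(1))
qed

text \<open>Differentiating \<open>zd l\<close> costs a factor \<open>lam l\<close>, which the hypothesis on \<open>d\<close> pays for.\<close>

lemma deriv_sum_deriv:
  assumes "tame (\<lambda>l. lam l * d l)" and x: "x \<in> {0..xm}"
  shows "(deriv_sum d has_real_derivative - eigen_sum (\<lambda>l. lam l * d l) x * \<rho> x) (at x within {0..xm})"
proof -
  obtain B where B: "summable B" "\<And>l x. x \<in> {0..xm} \<Longrightarrow> \<bar>lam l * d l * z l x\<bar> \<le> B l"
      "\<And>l x. x \<in> {0..xm} \<Longrightarrow> \<bar>lam l * d l * zd l x\<bar> \<le> B l"
    by (rule tame_bounds[OF assms(1)]) (rule that)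
  obtain R where R: "\<And>x. x \<in> {0..xm} \<Longrightarrow> \<bar>\<rho> x\<bar> \<le> R"
    by (rule continuous_on_Icc_bounded[OF cont_\<rho>]) (rule that)
  have d: "tame d" by (rule tame_if_lam_mult[OF assms(1)])
  have "((\<lambda>x. \<Sum>l. d l * zd l x) has_real_derivative (\<Sum>l. lam l * d l * z l x * - \<rho> x)) (at x within {0..xm})"
  proof (rule series_deriv[OF _ _ _ summable_mult2[OF B(1), of R] _ x])
    show "((\<lambda>x. d l * zd l x) has_real_derivative lam l * d l * z l x * - \<rho> x) (at x within {0..xm})"
      if "x \<in> {0..xm}" for l x
      using DERIV_cmult[OF zd_deriv[OF that, of l], of "d l"] by (simp add: mult_ac)
    show "\<bar>lam l * d l * z l x * - \<rho> x\<bar> \<le> B l * R" if "x \<in> {0..xm}" for l x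
    proof -
      have "\<bar>lam l * d l * z l x\<bar> * \<bar>\<rho> x\<bar> \<le> B l * R"
        using B(2)[OF that, of l] R[OF that] by (intro mult_mono) auto
      then show ?thesis by (simp only: abs_mult abs_minus_cancel)
    qed
  qed (intro continuous_on_mult continuous_on_const cont_z continuous_on_minus cont_\<rho> summable_expansion d; assumption)+
  also have "(\<Sum>l. lam l * d l * z l x * - \<rho> x) = - eigen_sum (\<lambda>l. lam l * d l) x * \<rho> x"
    unfolding eigen_sum_def using suminf_mult2[OF summable_expansion(1)[OF assms], of "- \<rho> x"] by simp
  finally show ?thesis unfolding deriv_sum_def .
qed

lemma ip_expansion:
  assumes "tame d" "continuous_on {0..xm} g"
  shows "(\<lambda>l. d l * ip v xm (z l) g) sums ip v xm (eigen_sum d) g"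
proof -
  obtain B where B: "summable B" "\<And>l x. x \<in> {0..xm} \<Longrightarrow> \<bar>d l * z l x\<bar> \<le> B l"
      "\<And>l x. x \<in> {0..xm} \<Longrightarrow> \<bar>d l * zd l x\<bar> \<le> B l"
    by (rule tame_bounds[OF assms(1)]) (rule that)
  have "(\<lambda>l. integral {0..xm} (\<lambda>x. d l * z l x * (g x * \<rho> x))) sums
      integral {0..xm} (\<lambda>x. (\<Sum>l. d l * z l x) * (g x * \<rho> x))"
    by (rule function_series_mult[OF _ B(2,1) continuous_on_mult[OF assms(2) cont_\<rho>]])
      (auto intro!: continuous_on_mult cont_z)
  then show ?thesis by (simp only: ip_eq eigen_sum_def mult.assoc integral_mult_right)
qed

lemma coefficient:
  assumes "tame d"
  shows "ip v xm (eigen_sum d) (z k) = d k"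
proof -
  have "(\<lambda>l. d l * ip v xm (z l) (z k)) = (\<lambda>l. if l = k then d l else 0)"
    by (auto simp: orthonormal)
  with ip_expansion[OF assms cont_z, of k] sums_single[of k d] show ?thesis
    by (metis sums_unique2)
qed

lemma ip_commute: "ip v xm f g = ip v xm g f"
  by (simp add: ip_eq mult_ac)

lemma parseval:
  assumes "tame d" "tame e"
  shows "(\<lambda>l. d l * e l) sums ip v xm (eigen_sum d) (eigen_sum e)"
  using ip_expansion[OF assms(1) cont_eigen_sum[OF assms(2)]] coefficient[OF assms(2)]
  by (simp add: ip_commute[of "z _"])

text \<open>The derivatives are orthogonal, but with squared norms \<open>lam l\<close>.\<close>

lemma parseval_derivative:
  assumes "tame d" "tame e"
  shows "(\<lambda>l. lam l * d l * e l) sums integral {0..xm} (\<lambda>x. deriv_sum d x * deriv_sum e x)"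
proof -
  have *: "(\<lambda>l. d l * integral {0..xm} (\<lambda>x. zd l x * g x)) sums integral {0..xm} (\<lambda>x. deriv_sum d x * g x)"
    if "tame d" "continuous_on {0..xm} g" for d g
  proof -
    obtain B where B: "summable B" "\<And>l x. x \<in> {0..xm} \<Longrightarrow> \<bar>d l * z l x\<bar> \<le> B l"
        "\<And>l x. x \<in> {0..xm} \<Longrightarrow> \<bar>d l * zd l x\<bar> \<le> B l"
      by (rule tame_bounds[OF \<open>tame d\<close>]) (rule that)
    have "(\<lambda>l. integral {0..xm} (\<lambda>x. d l * zd l x * g x)) sums
        integral {0..xm} (\<lambda>x. (\<Sum>l. d l * zd l x) * g x)"
      by (rule function_series_mult[OF _ B(3,1)])
        (auto intro!: continuous_on_mult cont_zd that(2))
    then show ?thesis by (simp only: deriv_sum_def mult.assoc integral_mult_right)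
  qed
  have "integral {0..xm} (\<lambda>x. deriv_sum e x * zd l x) = lam l * e l" for l
  proof -
    have "(\<lambda>k. e k * integral {0..xm} (\<lambda>x. zd k x * zd l x)) = (\<lambda>k. if k = l then lam k * e k else 0)"
      by (auto simp: zd_orthogonal)
    with *[OF assms(2) cont_zd, of l] sums_single[of l "\<lambda>k. lam k * e k"] show ?thesis
      by (metis sums_unique2)
  qed
  then have "integral {0..xm} (\<lambda>x. zd l x * deriv_sum e x) = lam l * e l" for l
    by (simp add: mult.commute)
  then show ?thesis using *[OF assms(1) cont_deriv_sum[OF assms(2)]] by (simp add: mult_ac)
qed

section \<open>Travel time\<close>

abbreviation "T \<equiv> travel_time v"
abbreviation "xi \<equiv> travel_time_inv v xm"

lemma T_0: "T 0 = 0" by (simp add: travel_time_def)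

lemma T_deriv: "x \<in> {0..xm} \<Longrightarrow> (T has_real_derivative 1 / v x) (at x within {0..xm})"
  unfolding travel_time_def
  by (rule integral_has_real_derivative)
    (auto intro!: continuous_intros cont_v dest: v_pos)

lemma cont_T: "continuous_on {0..xm} T" by (rule DERIV_continuous_on[OF T_deriv])

lemma T_less: assumes "0 \<le> x" "x < y" "y \<le> xm" shows "T x < T y"
proof (rule DERIV_pos_imp_increasing_open[OF assms(2)])
  show "\<exists>d. (T has_real_derivative d) (at t) \<and> d > 0" if "x < t" "t < y" for t
    using T_deriv[of t] v_pos[of t] that assms at_within_Icc_at[of 0 t xm] by auto
  show "continuous_on {x..y} T" by (rule continuous_on_subset[OF cont_T]) (use assms in auto)
qed

lemma inj_T: "inj_on T {0..xm}"
  by (rule linorder_inj_onI') (metis T_less atLeastAtMost_iff less_irrefl)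

lemma T_image: "T ` {0..xm} = {0..T xm}"
proof (intro equalityI subsetI)
  fix s assume "s \<in> T ` {0..xm}"
  then obtain x where x: "x \<in> {0..xm}" "s = T x" by blast
  then show "s \<in> {0..T xm}"
    using T_less[of 0 x] T_less[of x xm] T_0 by (cases "x = 0"; cases "x = xm") auto
next
  fix s assume "s \<in> {0..T xm}"
  then obtain x where "0 \<le> x" "x \<le> xm" "T x = s"
    using IVT'[of T 0 s xm] T_0 xm cont_T by auto
  then show "s \<in> T ` {0..xm}" by auto
qed

lemma xi_T: "x \<in> {0..xm} \<Longrightarrow> xi (T x) = x"
  unfolding travel_time_inv_def by (rule the_inv_into_f_f[OF inj_T])

lemma T_xi: "s \<in> {0..T xm} \<Longrightarrow> T (xi s) = s"
  unfolding travel_time_inv_def by (rule f_the_inv_into_f[OF inj_T]) (simp add: T_image)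

lemma xi_in: "s \<in> {0..T xm} \<Longrightarrow> xi s \<in> {0..xm}"
  unfolding travel_time_inv_def by (rule the_inv_into_into[OF inj_T]) (auto simp: T_image)

lemma T_xm_pos: "T xm > 0" using T_less[of 0 xm] xm T_0 by simp

lemma cont_xi: "continuous_on {0..T xm} xi"
  using continuous_on_inv[OF cont_T compact_Icc, of xi] xi_T by (simp add: T_image)

text \<open>The derivative is obtained from the difference quotients, since at the end points of the interval it is
  one-sided.\<close>

lemma xi_deriv:
  assumes s: "s \<in> {0..T xm}"
  shows "(xi has_real_derivative v (xi s)) (at s within {0..T xm})"
proof -
  have "((\<lambda>y. inverse ((T y - T (xi s)) / (y - xi s))) \<longlongrightarrow> inverse (1 / v (xi s)))
      (at (xi s) within {0..xm})"
    using T_deriv[OF xi_in[OF s]] v_pos[OF xi_in[OF s]]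
    by (intro tendsto_inverse) (auto simp: has_field_derivative_iff)
  moreover have "filterlim xi (at (xi s) within {0..xm}) (at s within {0..T xm})"
  proof -
    have "\<forall>\<^sub>F y in at s within {0..T xm}. xi y \<in> {0..xm} \<and> xi y \<noteq> xi s"
      unfolding eventually_at_filter using xi_in T_xi s by (intro always_eventually) metis
    moreover have "(xi \<longlongrightarrow> xi s) (at s within {0..T xm})"
      using cont_xi s by (simp add: continuous_on_def)
    ultimately show ?thesis by (simp add: filterlim_at)
  qed
  ultimately have "((\<lambda>y. inverse ((T (xi y) - T (xi s)) / (xi y - xi s))) \<longlongrightarrow> inverse (1 / v (xi s)))
      (at s within {0..T xm})"
    by (rule filterlim_compose)
  moreover have "\<forall>\<^sub>F y in at s within {0..T xm}.
      inverse ((T (xi y) - T (xi s)) / (xi y - xi s)) = (xi y - xi s) / (y - s)"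
    unfolding eventually_at_filter by (intro always_eventually) (auto simp: T_xi T_xi[OF s])
  ultimately have "((\<lambda>y. (xi y - xi s) / (y - s)) \<longlongrightarrow> inverse (1 / v (xi s))) (at s within {0..T xm})"
    by (rule Lim_transform_eventually)
  then show ?thesis by (simp add: has_field_derivative_iff)
qed

text \<open>Equality on the interval suffices because \<open>deriv_on\<close> differentiates within it.\<close>

lemma comp_xi_deriv:
  assumes "\<And>x. x \<in> {0..xm} \<Longrightarrow> (g has_real_derivative g' x) (at x within {0..xm})"
    and s: "s \<in> {0..T xm}"
    and h: "\<And>s. s \<in> {0..T xm} \<Longrightarrow> h s = g (xi s)"
  shows "deriv_on (T xm) h s = v (xi s) * g' (xi s)"
proof -
  have "(g \<circ> xi has_real_derivative g' (xi s) * v (xi s)) (at s within {0..T xm})"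
  proof (rule DERIV_image_chain)
    show "(g has_real_derivative g' (xi s)) (at (xi s) within xi ` {0..T xm})"
      by (rule DERIV_subset[OF assms(1)]) (use xi_in s in auto)
  qed (rule xi_deriv[OF s])
  then have "(h has_real_derivative g' (xi s) * v (xi s)) (at s within {0..T xm})"
    by (rule has_field_derivative_transform_within[where d = 1, OF _ _ s]) (simp_all add: h)
  then show ?thesis
    unfolding deriv_on_def using T_xm_pos s
    by (subst vector_derivative_within_closed_interval)
      (auto simp: has_real_derivative_iff_has_vector_derivative mult.commute)
qed

lemma integral_comp_xi:
  assumes "continuous_on {0..xm} g" and h: "\<And>s. s \<in> {0..T xm} \<Longrightarrow> h s = g (xi s)"
  shows "integral {0..T xm} h = integral {0..xm} (\<lambda>x. g x / v x)"
proof -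
  have "((\<lambda>x. (1 / v x) *\<^sub>R (g \<circ> xi) (T x)) has_integral (integral {T 0..T xm} (g \<circ> xi))) {0..xm}"
  proof (rule has_integral_substitution[where c = 0 and d = "T xm" and f = "g \<circ> xi" and g = T and g' = "\<lambda>x. 1 / v x"])
    show "continuous_on {0..T xm} (g \<circ> xi)"
      by (rule continuous_on_compose[OF cont_xi continuous_on_subset[OF assms(1)]]) (use xi_in in auto)
    show "T ` {0..xm} \<subseteq> {0..T xm}" by (simp add: T_image)
  qed (use T_0 T_xm_pos xm T_deriv in auto)
  then have "integral {0..T xm} (g \<circ> xi) = integral {0..xm} (\<lambda>x. (1 / v x) *\<^sub>R (g \<circ> xi) (T x))"
    by (simp only: T_0 integral_unique)
  also have "\<dots> = integral {0..xm} (\<lambda>x. g x / v x)" by (intro integral_cong) (simp add: xi_T)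
  also have "integral {0..T xm} (g \<circ> xi) = integral {0..T xm} h" by (intro integral_cong) (simp add: h)
  finally show ?thesis .
qed

lemma weighted_ip_travel_time:
  assumes "continuous_on {0..xm} f" "continuous_on {0..xm} g"
    and "\<And>s. s \<in> {0..T xm} \<Longrightarrow> h s = f (xi s)" "\<And>s. s \<in> {0..T xm} \<Longrightarrow> k s = g (xi s)"
  shows "weighted_ip (\<lambda>s. 1 / (v \<circ> xi) s) (T xm) h k = ip v xm f g"
proof -
  have "integral {0..T xm} (\<lambda>s. h s * k s * (1 / (v \<circ> xi) s)) = integral {0..xm} (\<lambda>x. f x * g x * (1 / v x) / v x)"
    by (rule integral_comp_xi)
      (use assms v_pos xi_in in \<open>auto intro!: continuous_intros cont_v simp: less_imp_neq[symmetric]\<close>)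
  also have "\<dots> = ip v xm f g"
    unfolding ip_eq by (intro integral_cong) (simp add: power2_eq_square)
  finally show ?thesis by (simp add: weighted_ip_def)
qed

text \<open>The functions \<open>w\<^sub>j\<close> of the process live in the space with the weight \<open>v\<close>; as functions of \<open>x\<close> they carry the weight
  \<open>1\<close>, for which the derivatives of the eigenfunctions are orthogonal.\<close>

lemma weighted_ip_travel_time_dual:
  assumes "continuous_on {0..xm} f" "\<And>s. s \<in> {0..T xm} \<Longrightarrow> h s = f (xi s)"
  shows "weighted_ip (v \<circ> xi) (T xm) h h = integral {0..xm} (\<lambda>x. f x * f x)"
proof -
  have "integral {0..T xm} (\<lambda>s. h s * h s * (v \<circ> xi) s) = integral {0..xm} (\<lambda>x. f x * f x * v x / v x)"
    by (rule integral_comp_xi) (use assms in \<open>auto intro!: continuous_intros cont_v\<close>)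
  also have "\<dots> = integral {0..xm} (\<lambda>x. f x * f x)"
    by (intro integral_cong) (use v_pos in \<open>auto simp: less_imp_neq[symmetric]\<close>)
  finally show ?thesis by (simp add: weighted_ip_def)
qed
end


section \<open>Snapshots as polynomials in the propagator\<close>

text \<open>The numbers \<open>bc l\<close> are the coefficients of the pulse \<open>b\<close>. They decay fast enough for two
  differentiations of the series.\<close>

locale snapshots = eigenfunctions +
  fixes \<tau> :: real and bc :: "nat \<Rightarrow> real"
  assumes \<tau>: "\<tau> > 0" and rapid: "tame (\<lambda>l. lam l * bc l)"
begin

text \<open>The eigenvalues of the propagator, and those of \<open>A\<^sup>-\<^sup>1\<^sup>/\<^sup>2 sin (\<tau>/2 A\<^sup>1\<^sup>/\<^sup>2)\<close>, which is the common part
  of \<open>L\<^sub>\<tau>\<close> and \<open>L\<^sub>\<tau>\<^sup>T\<close>.\<close>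

definition "mu l = cos (\<tau> * sqrt (lam l))"
definition "sg l = sin (\<tau> / 2 * sqrt (lam l)) / sqrt (lam l)"

text \<open>The function \<open>p(P) b\<close>.\<close>

definition \<Phi> :: "real poly \<Rightarrow> real \<Rightarrow> real" where
  "\<Phi> p = eigen_sum (\<lambda>l. poly p (mu l) * bc l)"

definition M :: "real poly \<Rightarrow> real" where
  "M p = (\<Sum>l. poly p (mu l) * (bc l)\<^sup>2)"

text \<open>The polynomial \<open>- \<xi>\<close> of the snapshot process, for which \<open>D(P) = v L\<^sub>\<tau>\<^sup>T (1 / v) L\<^sub>\<tau>\<close>.\<close>

definition D :: "real poly" where "D = [:2 / \<tau>\<^sup>2, - 2 / \<tau>\<^sup>2:]"

lemma poly_D: "poly D x = 2 / \<tau>\<^sup>2 * (1 - x)"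
  using \<tau> by (simp add: D_def field_simps)

lemma tame_bc: "tame bc" by (rule tame_if_lam_mult[OF rapid])

lemma poly_mu_bounded: obtains H where "\<And>l. \<bar>poly p (mu l)\<bar> \<le> H"
proof -
  obtain H where H: "\<And>x. x \<in> {-1..1} \<Longrightarrow> \<bar>poly p x\<bar> \<le> H"
    by (rule continuous_on_Icc_bounded[of "-1" 1 "poly p"]) (auto intro: continuous_intros that)
  show ?thesis by (rule that[of H]) (simp add: mu_def H)
qed

lemma sg_bounded: "\<bar>sg l\<bar> \<le> \<tau> / 2"
  using abs_sin_x_le_abs_x[of "\<tau> / 2 * sqrt (lam l)"] \<tau> lam_pos[of l]
  by (simp add: sg_def abs_mult field_simps)

text \<open>The half-angle formula. It is the reason why \<open>L\<^sub>\<tau>\<^sup>T\<close> and \<open>L\<^sub>\<tau>\<close> combine to a polynomial in \<open>P\<close>.\<close>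

lemma lam_sg_square: "lam l * (sg l)\<^sup>2 = (1 - mu l) / 2"
  using cos_double_sin[of "\<tau> / 2 * sqrt (lam l)"] lam_pos[of l]
  by (simp add: sg_def mu_def power_divide)

lemma tame_poly: "tame d \<Longrightarrow> tame (\<lambda>l. poly p (mu l) * d l)"
  by (rule poly_mu_bounded[of p]) (rule tame_mult_bounded)

lemma tame_sg: "tame d \<Longrightarrow> tame (\<lambda>l. sg l * d l)"
  by (rule tame_mult_bounded[OF _ sg_bounded])

lemma tame_\<Phi>: "tame (\<lambda>l. poly p (mu l) * bc l)" by (rule tame_poly[OF tame_bc])

lemma cont_\<Phi>: "continuous_on {0..xm} (\<Phi> p)" unfolding \<Phi>_def by (rule cont_eigen_sum[OF tame_\<Phi>])

lemma ip_\<Phi>_sums: "(\<lambda>l. poly (p * g) (mu l) * (bc l)\<^sup>2) sums ip v xm (\<Phi> p) (\<Phi> g)"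
  using parseval[OF tame_\<Phi>[of p] tame_\<Phi>[of g]] unfolding \<Phi>_def
  by (simp add: power2_eq_square algebra_simps)

lemma ip_\<Phi>: "ip v xm (\<Phi> p) (\<Phi> g) = M (p * g)"
  unfolding M_def by (rule sums_unique[OF ip_\<Phi>_sums])

lemma M_sums: "(\<lambda>l. poly p (mu l) * (bc l)\<^sup>2) sums M p"
  using ip_\<Phi>_sums[of p 1] by (simp add: ip_\<Phi>)

lemma M_linear: "positive_moments M 0"
proof
  show "M (p + g) = M p + M g" for p g
    by (rule sums_unique2[OF M_sums]) (use sums_add[OF M_sums[of p] M_sums[of g]] in \<open>simp add: algebra_simps\<close>)
  show "M (Polynomial.smult a p) = a * M p" for a p
    by (rule sums_unique2[OF M_sums]) (use sums_mult[OF M_sums[of p], of a] in \<open>simp add: algebra_simps\<close>)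
qed simp

lemma \<Phi>_add_smult:
  "x \<in> {0..xm} \<Longrightarrow> \<Phi> (p + Polynomial.smult a g) x = \<Phi> p x + a * \<Phi> g x"
  unfolding \<Phi>_def expansion_linear(1)[OF tame_\<Phi> tame_\<Phi>, symmetric] by (simp add: algebra_simps)

lemma \<Phi>_0: "\<Phi> 0 x = 0" by (simp add: \<Phi>_def eigen_sum_def)

lemma \<Phi>_smult: "x \<in> {0..xm} \<Longrightarrow> \<Phi> (Polynomial.smult a g) x = a * \<Phi> g x"
  using \<Phi>_add_smult[of x 0 a g] by (simp add: \<Phi>_0)

lemma \<Phi>_combination:
  fixes k :: nat
  shows "x \<in> {0..xm} \<Longrightarrow> \<Phi> (\<Sum>i<k. Polynomial.smult (a i) (g i)) x = (\<Sum>i<k. a i * \<Phi> (g i) x)"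
  by (induction k) (simp_all add: \<Phi>_0 \<Phi>_add_smult)

lemma cos_sqrt_A_expansion:
  assumes "tame d" "\<And>x. x \<in> {0..xm} \<Longrightarrow> g x = eigen_sum d x"
  shows "cos_sqrt_A v xm lam z t g = eigen_sum (\<lambda>l. cos (t * sqrt (lam l)) * d l)"
proof -
  have "ip v xm g (z l) = d l" for l
    using ip_cong[of g "eigen_sum d" "z l" "z l"] assms coefficient[OF assms(1)] by simp
  then show ?thesis by (simp add: cos_sqrt_A_def spectral_apply_def eigen_sum_def fun_eq_iff)
qed

lemma propagator_\<Phi>:
  assumes "\<And>x. x \<in> {0..xm} \<Longrightarrow> g x = \<Phi> p x"
  shows "cos_sqrt_A v xm lam z \<tau> g = \<Phi> ([:0, 1:] * p)"
  using cos_sqrt_A_expansion[OF tame_\<Phi>, of g p \<tau>] assms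
  by (simp add: \<Phi>_def mu_def mult.assoc)

lemma snapshot_\<Phi>:
  assumes "\<And>x. x \<in> {0..xm} \<Longrightarrow> g x = eigen_sum bc x"
  shows "cos_sqrt_A v xm lam z (real k * \<tau>) g = \<Phi> (cheb_poly k)"
  using cos_sqrt_A_expansion[OF tame_bc, of g "real k * \<tau>"] assms
  by (simp add: \<Phi>_def mu_def poly_cheb_poly cheb_T_cos mult.assoc)

section \<open>The orthogonalization process\<close>

abbreviation "vt \<equiv> v \<circ> xi"
abbreviation "zt \<equiv> \<lambda>l. z l \<circ> xi"

text \<open>The factor \<open>v (xi s)\<close> comes from differentiating with respect to travel time. It is cancelled in the
  process, which uses \<open>(1 / v) L\<^sub>\<tau>\<close>.\<close>

lemma L_op_expansion:
  assumes "tame d" "\<And>s. s \<in> {0..T xm} \<Longrightarrow> h s = eigen_sum d (xi s)" and s: "s \<in> {0..T xm}"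
  shows "L_op vt (T xm) \<tau> lam zt h s = 2 / \<tau> * (v (xi s) * deriv_sum (\<lambda>l. sg l * d l) (xi s))"
proof -
  have "weighted_ip (\<lambda>r. 1 / vt r) (T xm) h (zt l) = d l" for l
    using weighted_ip_travel_time[OF cont_eigen_sum[OF assms(1)] cont_z assms(2), where k = "zt l"]
      coefficient[OF assms(1)] by simp
  then have "spectral_apply lam zt (\<lambda>r. sin (\<tau> / 2 * sqrt r) / sqrt r)
      (weighted_ip (\<lambda>r. 1 / vt r) (T xm) h) = (\<lambda>s. eigen_sum (\<lambda>l. sg l * d l) (xi s))"
    by (simp add: spectral_apply_def eigen_sum_def sg_def fun_eq_iff)
  then show ?thesis
    unfolding L_op_def
    by (simp only: comp_xi_deriv[OF eigen_sum_deriv[OF tame_sg[OF assms(1)]] s])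
qed

text \<open>The series \<open>deriv_sum e\<close> in the derivatives of the eigenfunctions is differentiated once more, and the
  eigenvalue equation turns the result into a series in the eigenfunctions with an additional factor
  \<open>lam l\<close>.\<close>

lemma LT_op_expansion:
  assumes "tame (\<lambda>l. lam l * e l)" "\<And>s. s \<in> {0..T xm} \<Longrightarrow> h s = k * deriv_sum e (xi s)"
    and s: "s \<in> {0..T xm}"
  shows "vt s * LT_op vt (T xm) \<tau> lam zt h s = 2 / \<tau> * k * eigen_sum (\<lambda>l. sg l * (lam l * e l)) (xi s)"
proof -
  let ?d = "\<lambda>l. - k * (lam l * e l)"
  have d: "tame ?d" by (rule tame_cmult[OF assms(1)])
  have Zd: "eigen_sum ?d x = - k * eigen_sum (\<lambda>l. lam l * e l) x" if "x \<in> {0..xm}" for x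
    using suminf_mult[OF summable_expansion(1)[OF assms(1) that], of "- k"]
    by (simp add: eigen_sum_def mult_ac)
  have deriv: "vt r * deriv_on (T xm) h r = eigen_sum ?d (xi r)" if r: "r \<in> {0..T xm}" for r
  proof -
    have "deriv_on (T xm) h r = v (xi r) * (k * (- eigen_sum (\<lambda>l. lam l * e l) (xi r) * \<rho> (xi r)))"
      by (rule comp_xi_deriv[where g = "\<lambda>x. k * deriv_sum e x",
            OF DERIV_cmult[OF deriv_sum_deriv[OF assms(1)]] r assms(2)])
    then show ?thesis
      using Zd[OF xi_in[OF r]] v_pos[OF xi_in[OF r]] by (simp add: power2_eq_square)
  qed
  have "weighted_ip (\<lambda>r. 1 / vt r) (T xm) (\<lambda>r. vt r * deriv_on (T xm) h r) (zt l) = ?d l" for l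
    using weighted_ip_travel_time[OF cont_eigen_sum[OF d] cont_z deriv, where k = "zt l"]
      coefficient[OF d] by simp
  then have "spectral_apply lam zt (\<lambda>r. sin (\<tau> / 2 * sqrt r) / sqrt r)
      (weighted_ip (\<lambda>r. 1 / vt r) (T xm) (\<lambda>r. vt r * deriv_on (T xm) h r)) s
      = (\<Sum>l. - k * (sg l * (lam l * e l) * z l (xi s)))"
    by (simp add: spectral_apply_def sg_def mult_ac)
  also have "\<dots> = - k * eigen_sum (\<lambda>l. sg l * (lam l * e l)) (xi s)"
    unfolding eigen_sum_def
    by (rule suminf_mult[OF summable_expansion(1)[OF tame_sg[OF assms(1)] xi_in[OF s]]])
  finally show ?thesis
    using v_pos[OF xi_in[OF s]] by (simp add: LT_op_def)
qed

text \<open>Up to the factor \<open>2 / \<tau>\<close>, these are the coefficients of \<open>(1 / v) L\<^sub>\<tau> p(P) b\<close> with respect to the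
  derivatives of the eigenfunctions.\<close>

definition dual_coeff :: "real poly \<Rightarrow> nat \<Rightarrow> real" where
  "dual_coeff p l = sg l * (poly p (mu l) * bc l)"

lemma tame_lam_dual_coeff: "tame (\<lambda>l. lam l * dual_coeff p l)"
  using tame_sg[OF tame_poly[OF rapid]] by (simp add: dual_coeff_def mult_ac)

lemma tame_dual_coeff: "tame (dual_coeff p)"
  by (rule tame_if_lam_mult[OF tame_lam_dual_coeff])

text \<open>On coefficients, one step of the process applies \<open>(1 / v) L\<^sub>\<tau>\<close> and then \<open>v L\<^sub>\<tau>\<^sup>T\<close>, which amounts to
  multiplication by \<open>D\<close> at \<open>mu l\<close>. The squared norms in the process are the values of \<open>M\<close> in
  \<open>coupled_polys\<close>, by Parseval's identity for the eigenfunctions and for their derivatives.\<close>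

lemma orth_process_eq:
  assumes bt: "\<And>s. s \<in> {0..T xm} \<Longrightarrow> bt s = eigen_sum bc (xi s)"
  shows "s \<in> {0..T xm} \<Longrightarrow>
     fst (orth_process vt (T xm) \<tau> lam zt bt j) s =
       2 / \<tau> * deriv_sum (dual_coeff (fst (coupled_polys M D j))) (xi s) \<and>
     snd (orth_process vt (T xm) \<tau> lam zt bt j) s = \<Phi> (snd (coupled_polys M D j)) (xi s)"
proof (induction j arbitrary: s)
  case 0
  then show ?case using bt by (simp add: deriv_sum_def dual_coeff_def \<Phi>_def)
next
  case (Suc j)
  define w h where "w = fst (orth_process vt (T xm) \<tau> lam zt bt j)"
    and "h = snd (orth_process vt (T xm) \<tau> lam zt bt j)"
  define sp p where "sp = fst (coupled_polys M D j)" and "p = snd (coupled_polys M D j)"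
  have IH: "w r = 2 / \<tau> * deriv_sum (dual_coeff sp) (xi r)" "h r = \<Phi> p (xi r)" if "r \<in> {0..T xm}" for r
    using Suc.IH[OF that] unfolding w_def h_def sp_def p_def by blast+
  define \<gamma>' where "\<gamma>' = 1 / weighted_ip (\<lambda>s. 1 / vt s) (T xm) h h"
  define sp' where "sp' = sp + Polynomial.smult \<gamma>' p"
  define w' where "w' = (\<lambda>s. w s + \<gamma>' * (1 / vt s) * L_op vt (T xm) \<tau> lam zt h s)"
  define \<gamma> where "\<gamma> = 1 / weighted_ip vt (T xm) w' w'"
  have "weighted_ip (\<lambda>s. 1 / vt s) (T xm) h h = M (p * p)"
    unfolding ip_\<Phi>[symmetric] by (rule weighted_ip_travel_time[OF cont_\<Phi> cont_\<Phi> IH(2) IH(2)])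
  then have \<gamma>': "\<gamma>' = 1 / M (p * p)" by (simp only: \<gamma>'_def)
  have w': "w' r = 2 / \<tau> * deriv_sum (dual_coeff sp') (xi r)" if r: "r \<in> {0..T xm}" for r
  proof -
    have L: "L_op vt (T xm) \<tau> lam zt h r = 2 / \<tau> * (v (xi r) * deriv_sum (dual_coeff p) (xi r))"
      unfolding dual_coeff_def[abs_def]
      by (rule L_op_expansion[OF tame_\<Phi> _ r]) (use IH(2) in \<open>simp add: \<Phi>_def\<close>)
    have "w' r = 2 / \<tau> * (deriv_sum (dual_coeff sp) (xi r) + \<gamma>' * deriv_sum (dual_coeff p) (xi r))"
      unfolding w'_def L IH(1)[OF r] using v_pos[OF xi_in[OF r]] by (simp add: distrib_left)
    also have "deriv_sum (dual_coeff sp) (xi r) + \<gamma>' * deriv_sum (dual_coeff p) (xi r) =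
        deriv_sum (\<lambda>l. dual_coeff sp l + \<gamma>' * dual_coeff p l) (xi r)"
      by (rule expansion_linear(2)[OF tame_dual_coeff tame_dual_coeff xi_in[OF r], symmetric])
    also have "(\<lambda>l. dual_coeff sp l + \<gamma>' * dual_coeff p l) = dual_coeff sp'"
      by (simp add: dual_coeff_def sp'_def fun_eq_iff algebra_simps)
    finally show ?thesis .
  qed
  have \<gamma>: "\<gamma> = 1 / M (D * (sp' * sp'))"
  proof -
    have "weighted_ip vt (T xm) w' w' =
        integral {0..xm} (\<lambda>x. 2 / \<tau> * deriv_sum (dual_coeff sp') x * (2 / \<tau> * deriv_sum (dual_coeff sp') x))"
      by (rule weighted_ip_travel_time_dual[OF continuous_on_mult[OF continuous_on_const cont_deriv_sum[OF tame_dual_coeff]] w'])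
    also have "\<dots> = (2 / \<tau>)\<^sup>2 * integral {0..xm} (\<lambda>x. deriv_sum (dual_coeff sp') x * deriv_sum (dual_coeff sp') x)"
      unfolding integral_mult_right[symmetric] by (simp add: power2_eq_square mult_ac)
    also have "\<dots> = M (D * (sp' * sp'))"
    proof (rule sums_unique2[OF sums_mult[OF parseval_derivative[OF tame_dual_coeff tame_dual_coeff]]])
      have "(2 / \<tau>)\<^sup>2 * (lam l * dual_coeff sp' l * dual_coeff sp' l) =
          poly (D * (sp' * sp')) (mu l) * (bc l)\<^sup>2" for l
      proof -
        have "lam l * dual_coeff sp' l * dual_coeff sp' l =
            (lam l * (sg l)\<^sup>2) * (poly sp' (mu l) * bc l)\<^sup>2"
          by (simp add: dual_coeff_def power2_eq_square mult_ac)
        also have "(2 / \<tau>)\<^sup>2 * \<dots> = 2 / \<tau>\<^sup>2 * (1 - mu l) * (poly sp' (mu l) * bc l)\<^sup>2"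
          unfolding lam_sg_square by (simp add: power_divide)
        also have "\<dots> = poly (D * (sp' * sp')) (mu l) * (bc l)\<^sup>2"
          by (simp add: poly_D power2_eq_square mult_ac)
        finally show ?thesis .
      qed
      then show "(\<lambda>l. (2 / \<tau>)\<^sup>2 * (lam l * dual_coeff sp' l * dual_coeff sp' l)) sums M (D * (sp' * sp'))"
        by (simp only: M_sums)
    qed
    finally show ?thesis by (simp add: \<gamma>_def)
  qed
  have LT: "vt s * LT_op vt (T xm) \<tau> lam zt w' s = \<Phi> (D * sp') (xi s)"
  proof -
    have coeff: "sg l * (lam l * dual_coeff sp' l) = (lam l * (sg l)\<^sup>2) * (poly sp' (mu l) * bc l)" for l
      by (simp add: dual_coeff_def power2_eq_square mult_ac)
    have "2 / \<tau> * (2 / \<tau>) * eigen_sum (\<lambda>l. sg l * (lam l * dual_coeff sp' l)) (xi s) =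
        (\<Sum>l. 2 / \<tau> * (2 / \<tau>) * (sg l * (lam l * dual_coeff sp' l) * z l (xi s)))"
      unfolding eigen_sum_def
      by (rule suminf_mult[OF summable_expansion(1)[OF tame_sg[OF tame_lam_dual_coeff] xi_in[OF Suc.prems]], symmetric])
    also have "\<dots> = \<Phi> (D * sp') (xi s)"
      unfolding \<Phi>_def eigen_sum_def coeff lam_sg_square
      by (intro suminf_cong) (simp add: poly_D power2_eq_square)
    finally have "2 / \<tau> * (2 / \<tau>) * eigen_sum (\<lambda>l. sg l * (lam l * dual_coeff sp' l)) (xi s) = \<Phi> (D * sp') (xi s)" .
    moreover have "vt s * LT_op vt (T xm) \<tau> lam zt w' s =
        2 / \<tau> * (2 / \<tau>) * eigen_sum (\<lambda>l. sg l * (lam l * dual_coeff sp' l)) (xi s)"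
      by (rule LT_op_expansion) (fact tame_lam_dual_coeff w' Suc.prems)+
    ultimately show ?thesis by (rule trans[rotated])
  qed
  have process: "orth_process vt (T xm) \<tau> lam zt bt (Suc j) =
      (w', \<lambda>s. h s - \<gamma> * vt s * LT_op vt (T xm) \<tau> lam zt w' s)"
    by (simp add: Let_def w_def h_def w'_def \<gamma>'_def \<gamma>_def split: prod.split)
  have polys: "coupled_polys M D (Suc j) = (sp', p - Polynomial.smult \<gamma> (D * sp'))"
    unfolding \<gamma> sp'_def \<gamma>' by (simp add: Let_def sp_def p_def split: prod.split)
  have "h s - \<gamma> * vt s * LT_op vt (T xm) \<tau> lam zt w' s = \<Phi> p (xi s) - \<gamma> * \<Phi> (D * sp') (xi s)"
    unfolding IH(2)[OF Suc.prems] LT[symmetric] by (simp only: mult.assoc)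
  also have "\<dots> = \<Phi> (p - Polynomial.smult \<gamma> (D * sp')) (xi s)"
    using \<Phi>_add_smult[OF xi_in[OF Suc.prems], of p "- \<gamma>" "D * sp'"] by simp
  finally show ?case unfolding process polys using w'[OF Suc.prems] by simp
qed

lemma orth_snapshot_eq:
  assumes b: "\<And>x. x \<in> {0..xm} \<Longrightarrow> b x = eigen_sum bc x" and x: "x \<in> {0..xm}"
  shows "orth_snapshot v xm b \<tau> lam z j x = \<Phi> (snd (coupled_polys M D (j - 1))) x"
    and "normalized_snapshot v xm b \<tau> lam z j x =
      \<Phi> (snd (coupled_polys M D (j - 1))) x /
      sqrt (M (snd (coupled_polys M D (j - 1)) * snd (coupled_polys M D (j - 1))))"
proof -
  let ?p = "snd (coupled_polys M D (j - 1))"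
  define h where "h = orth_snapshot_travel v xm b \<tau> lam z j"
  have h: "h s = \<Phi> ?p (xi s)" if "s \<in> {0..T xm}" for s
    unfolding h_def orth_snapshot_travel_def Let_def
    using orth_process_eq[of "b \<circ> xi" s "j - 1"] b xi_in that by simp
  have Tx: "T x \<in> {0..T xm}" using x T_image by blast
  show *: "orth_snapshot v xm b \<tau> lam z j x = \<Phi> ?p x"
    unfolding orth_snapshot_def h_def[symmetric] using h[OF Tx] x by (simp add: xi_T)
  have "weighted_ip (\<lambda>s. 1 / vt s) (T xm) h h = M (?p * ?p)"
    unfolding ip_\<Phi>[symmetric] by (rule weighted_ip_travel_time[OF cont_\<Phi> cont_\<Phi> h h])
  then show "normalized_snapshot v xm b \<tau> lam z j x = \<Phi> ?p x / sqrt (M (?p * ?p))"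
    unfolding normalized_snapshot_def Let_def h_def[symmetric] * by (simp only:)
qed
end


section \<open>Projection onto the Krylov subspace\<close>

text \<open>A nonzero polynomial of degree less than \<open>n\<close> cannot vanish at \<open>n\<close> distinct nodes. The factors \<open>g\<close>
  allow for the weight \<open>D\<close>.\<close>

lemma quadrature_sum_pos:
  fixes \<theta> y g :: "nat \<Rightarrow> real"
  assumes y: "\<And>j. j \<in> {1..n} \<Longrightarrow> y j > 0" and inj: "inj_on \<theta> {1..n}"
    and g: "\<And>j. j \<in> {1..n} \<Longrightarrow> g j > 0" and p: "p \<noteq> 0" "degree p < n"
  shows "(\<Sum>j=1..n. (y j)\<^sup>2 * (g j * (poly p (\<theta> j))\<^sup>2)) > 0"
proof -
  have "\<exists>j\<in>{1..n}. poly p (\<theta> j) \<noteq> 0"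
  proof (rule ccontr)
    assume "\<not> ?thesis"
    then have "\<theta> ` {1..n} \<subseteq> {t. poly p t = 0}" by auto
    then have "card (\<theta> ` {1..n}) \<le> card {t. poly p t = 0}"
      by (intro card_mono poly_roots_finite p(1))
    also have "\<dots> \<le> degree p" by (rule card_poly_roots_bound[OF p(1)])
    finally have "card {1..n} \<le> degree p" unfolding card_image[OF inj] .
    then show False using p(2) by simp
  qed
  then obtain i where i: "i \<in> {1..n}" "poly p (\<theta> i) \<noteq> 0" by blast
  show ?thesis
  proof (rule sum_pos2[OF _ i(1)])
    show "0 < (y i)\<^sup>2 * (g i * (poly p (\<theta> i))\<^sup>2)" using y[OF i(1)] g[OF i(1)] i(2) by simp
    show "0 \<le> (y j)\<^sup>2 * (g j * (poly p (\<theta> j))\<^sup>2)" if "j \<in> {1..n}" for j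
      using g[OF that] by simp
  qed simp
qed

lemma span_on_reindex: "span_on S {1..n} F = span_on S {0..<n} (\<lambda>k. F (Suc k))"
proof -
  have eq: "(\<Sum>k=1..n. a k * F k x) = (\<Sum>k\<in>{0..<n}. a (Suc k) * F (Suc k) x)" for a x
    by (simp add: sum.atLeast1_atMost_eq lessThan_atLeast0)
  show ?thesis
  proof (intro equalityI subsetI)
    fix h assume "h \<in> span_on S {1..n} F"
    then obtain a where "h = restrict (\<lambda>x. \<Sum>k=1..n. a k * F k x) S"
      unfolding span_on_def by blast
    then have "h = restrict (\<lambda>x. \<Sum>k\<in>{0..<n}. a (Suc k) * F (Suc k) x) S" by (simp only: eq)
    then show "h \<in> span_on S {0..<n} (\<lambda>k. F (Suc k))"
      unfolding span_on_def by (intro CollectI exI[of _ "\<lambda>k. a (Suc k)"]) simp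
  next
    fix h assume "h \<in> span_on S {0..<n} (\<lambda>k. F (Suc k))"
    then obtain a where "h = restrict (\<lambda>x. \<Sum>k\<in>{0..<n}. a k * F (Suc k) x) S"
      unfolding span_on_def by blast
    then have "h = restrict (\<lambda>x. \<Sum>k=1..n. a (k - 1) * F k x) S" unfolding eq by simp
    then show "h \<in> span_on S {1..n} F"
      unfolding span_on_def by (intro CollectI exI[of _ "\<lambda>k. a (k - 1)"]) simp
  qed
qed

text \<open>Polynomials of the degrees \<open>0, \<dots>, n - 1\<close> form a basis of the polynomials of degree less than \<open>n\<close>, so
  the span does not depend on the family.\<close>

lemma (in snapshots) span_on_\<Phi>:
  assumes "\<And>k x. k < n \<Longrightarrow> x \<in> {0..xm} \<Longrightarrow> F k x = \<Phi> (g k) x"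
    and deg: "\<And>k. k < n \<Longrightarrow> degree (g k) = k" "\<And>k. k < n \<Longrightarrow> g k \<noteq> 0" and "n \<ge> 1"
  shows "span_on {0..xm} {0..<n} F = {restrict (\<Phi> p) {0..xm} |p. degree p < n}"
proof -
  have eq: "restrict (\<lambda>x. \<Sum>k\<in>{0..<n}. a k * F k x) {0..xm} =
      restrict (\<Phi> (\<Sum>k<n. Polynomial.smult (a k) (g k))) {0..xm}" for a
    by (intro restrict_ext) (simp add: atLeast0LessThan \<Phi>_combination assms(1))
  have "degree (\<Sum>k<n. Polynomial.smult (a k) (g k)) < n" for a
    using deg \<open>n \<ge> 1\<close>
    by (intro degree_sum_less) (auto intro: le_less_trans[OF degree_smult_le])
  then show ?thesis
    unfolding span_on_def eq using triangular_family_spans[OF deg]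
    by (intro equalityI subsetI) (blast, fastforce)
qed

lemma lanczos_next: "fst (snd (lanczos S (Suc j))) = snd (snd (lanczos S j))"
  by (simp add: Let_def split: prod.split)

locale snapshot_quadrature = snapshots +
  fixes n :: nat and \<theta> y :: "nat \<Rightarrow> real" and c :: real
  assumes n: "n \<ge> 1" and c: "c = M 1"
    and y_pos: "j \<in> {1..n} \<Longrightarrow> y j > 0" and \<theta>_less: "j \<in> {1..n} \<Longrightarrow> \<theta> j < 1"
    and inj_\<theta>: "inj_on \<theta> {1..n}"
    and moments: "k < 2 * n \<Longrightarrow> (\<Sum>j=1..n. (y j)\<^sup>2 * cheb_T k (\<theta> j)) = M (cheb_poly k)"
begin

definition Q :: "real poly \<Rightarrow> real" where "Q p = (\<Sum>j=1..n. (y j)\<^sup>2 * poly p (\<theta> j))"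

lemma Q_smult: "Q (Polynomial.smult a p) = a * Q p"
  by (simp add: Q_def sum_distrib_left mult.left_commute)

text \<open>Both sides are linear and agree on the Chebyshev polynomials of degree less than \<open>2n\<close>.\<close>

lemma quadrature_exact:
  assumes "degree p < 2 * n"
  shows "Q p = M p"
proof -
  interpret M: positive_moments M 0 by (rule M_linear)
  interpret Q: positive_moments Q 0
    by unfold_locales
      (simp_all add: Q_def distrib_left sum.distrib sum_distrib_left mult.left_commute)
  obtain a where p: "p = (\<Sum>i<2 * n. Polynomial.smult (a i) (cheb_poly i))"
    using triangular_family_spans[of "2 * n" cheb_poly p] degree_cheb_poly assms by blast
  have "Q (cheb_poly i) = M (cheb_poly i)" if "i < 2 * n" for i
    using moments[OF that] by (simp add: Q_def poly_cheb_poly)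
  then show ?thesis unfolding p by (simp add: M.sum Q.sum M.scale Q.scale)
qed

sublocale coupled_recursion M n D
proof -
  interpret M: positive_moments M 0 by (rule M_linear)
  show "coupled_recursion M n D"
  proof
    show "degree D = 1" "lead_coeff D < 0" using \<tau> by (simp_all add: D_def)
    fix p :: "real poly" assume p: "p \<noteq> 0" "degree p < n"
    have "Q (p * p) > 0"
      using quadrature_sum_pos[of n y \<theta> "\<lambda>_. 1" p] y_pos inj_\<theta> p
      by (simp add: Q_def power2_eq_square)
    then show "M (p * p) > 0"
      using quadrature_exact[of "p * p"] p by (simp add: degree_mult_eq)
    have "Q (D * (p * p)) = (\<Sum>j=1..n. (y j)\<^sup>2 * (poly D (\<theta> j) * (poly p (\<theta> j))\<^sup>2))"
      by (simp add: Q_def power2_eq_square mult_ac)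
    also have "\<dots> > 0"
      by (rule quadrature_sum_pos[OF y_pos inj_\<theta> _ p]) (use \<theta>_less \<tau> in \<open>simp_all add: poly_D\<close>)
    finally have "Q (D * (p * p)) > 0" .
    moreover have "degree (D * (p * p)) < 2 * n"
    proof -
      have "D \<noteq> 0" "degree D = 1" using \<tau> by (auto simp: D_def)
      then show ?thesis using p by (simp add: degree_mult_eq)
    qed
    ultimately show "M (D * (p * p)) > 0" using quadrature_exact by simp
  qed (use M.add M.scale in auto)
qed

lemma c_pos: "c > 0"
  using norm_pp[of 0] n by (simp add: c pp_0)

text \<open>The normalized snapshot number \<open>i + 1\<close> is \<open>\<Phi> (orthopoly i)\<close>.\<close>

definition orthopoly :: "nat \<Rightarrow> real poly" where
  "orthopoly i = Polynomial.smult (1 / sqrt (M (pp i * pp i))) (pp i)"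

lemma degree_orthopoly: "i < n \<Longrightarrow> degree (orthopoly i) = i"
  using degrees_and_leads[of i] norm_pp[of i] by (simp add: orthopoly_def)

lemma lead_orthopoly: "i < n \<Longrightarrow> lead_coeff (orthopoly i) > 0"
  using degrees_and_leads[of i] norm_pp[of i] by (auto simp: orthopoly_def)

lemma orthopoly_nonzero: "i < n \<Longrightarrow> orthopoly i \<noteq> 0"
  using lead_orthopoly[of i] by (metis coeff_0 less_irrefl)

lemma orthopoly_orthonormal:
  assumes "i < n" "j < n"
  shows "M (orthopoly i * orthopoly j) = (if i = j then 1 else 0)"
  using pp_orthogonal[OF assms] norm_pp[OF assms(1)]
  by (auto simp: orthopoly_def scale real_sqrt_mult_self)

text \<open>The inner product \<open>S\<close> contains the factor \<open>1 / c\<close>, so its orthonormal polynomials are those of \<open>M\<close>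
  multiplied by \<open>sqrt c\<close>; the recursion coefficients are the same. Exactness of the quadrature covers
  the products with \<open>x\<close>, because their degree is at most \<open>2n - 1\<close>.\<close>

lemma lanczos_orthopoly:
  assumes "S = quadrature_ip n c \<theta> y" "j < n"
  shows "lanczos S j = (if j = 0 then (0, 0, Polynomial.smult (sqrt c) (orthopoly 0))
     else (M (orthopoly j * ([:0, 1:] * orthopoly (j - 1))), Polynomial.smult (sqrt c) (orthopoly (j - 1)),
        Polynomial.smult (sqrt c) (orthopoly j)))"
proof -
  define L where "L p = Q p / c" for p
  define g where "g i = Polynomial.smult (sqrt c) (orthopoly i)" for i
  have cc: "sqrt c * sqrt c = c" "sqrt c \<noteq> 0" using c_pos by simp_all
  have L: "positive_moments L n"
  proof
    show "L (p + r) = L p + L r" for p r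
      by (simp add: L_def Q_def distrib_left sum.distrib add_divide_distrib)
    show "L (Polynomial.smult a p) = a * L p" for a p
      by (simp add: L_def Q_smult)
    show "L (p * p) > 0" if "p \<noteq> 0" "degree p < n" for p
      using pos[OF that] quadrature_exact[of "p * p"] that c_pos by (simp add: L_def degree_mult_eq)
  qed
  have S: "S p r = L (p * r)" for p r
    by (simp add: assms(1) quadrature_ip_def L_def Q_def mult.assoc)
  have deg_g: "degree (g i) = i" if "i < n" for i using degree_orthopoly[OF that] cc by (simp add: g_def)
  have Lg: "L (r * g i * g k) = M (r * orthopoly i * orthopoly k)" if "degree (r * orthopoly i * orthopoly k) < 2 * n" for r i k
  proof -
    have "r * g i * g k = Polynomial.smult c (r * orthopoly i * orthopoly k)"
      using cc by (simp add: g_def)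
    then show ?thesis using quadrature_exact[of "r * orthopoly i * orthopoly k"] that c_pos
      by (simp add: L_def Q_smult)
  qed
  have "lanczos S j = (if j = 0 then (0, 0, g 0)
     else (L (g j * ([:0, 1:] * g (j - 1))), g (j - 1), g j))"
  proof (rule positive_moments.lanczos_reproduces_orthonormal_family[OF L S deg_g _ _ _ assms(2)])
    show "lead_coeff (g i) > 0" if "i < n" for i
      using lead_orthopoly[OF that] c_pos by (simp add: g_def)
    show "L (g i * g k) = (if i = k then 1 else 0)" if "i < n" "k < n" for i k
    proof -
      have "degree (1 * orthopoly i * orthopoly k) < 2 * n"
        using degree_orthopoly that orthopoly_nonzero by (simp add: degree_mult_eq)
      from Lg[OF this] show ?thesis using orthopoly_orthonormal[OF that] by simp
    qed
    show "L 1 = 1" using quadrature_exact[of 1] c c_pos n by (simp add: L_def)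
  qed
  moreover have "L (g j * ([:0, 1:] * g (j - 1))) = M (orthopoly j * ([:0, 1:] * orthopoly (j - 1)))" if "j \<noteq> 0"
  proof -
    have "degree ([:0, 1:] * orthopoly j * orthopoly (j - 1)) < 2 * n"
      using degree_orthopoly orthopoly_nonzero assms(2) that by (subst degree_mult_eq; simp)+
    from Lg[OF this] show ?thesis by (simp add: mult_ac)
  qed
  ultimately show ?thesis by (simp add: g_def)
qed

text \<open>The coefficient \<open>\<alpha>\<^sub>n\<close> is read from state \<open>n\<close> of the process, but involves only the polynomial that
  state \<open>n - 1\<close> has produced. In state \<open>n\<close> itself the new norm vanishes, since there are only \<open>n\<close> nodes.\<close>

lemma jacobi_entries:
  assumes S: "S = quadrature_ip n c \<theta> y"
  shows "j < n \<Longrightarrow> lanczos_alpha S (Suc j) = M (orthopoly j * ([:0, 1:] * orthopoly j))"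
    and "Suc j < n \<Longrightarrow> lanczos_beta S (Suc j) = M (orthopoly (Suc j) * ([:0, 1:] * orthopoly j))"
proof -
  assume j: "j < n"
  have "snd (snd (lanczos S j)) = Polynomial.smult (sqrt c) (orthopoly j)"
    using lanczos_orthopoly[OF S j] by auto
  then have "lanczos_alpha S (Suc j) =
      S (Polynomial.smult (sqrt c) (orthopoly j)) ([:0, 1:] * Polynomial.smult (sqrt c) (orthopoly j))"
    unfolding lanczos_alpha_def Let_def lanczos_next by simp
  also have "\<dots> = Q (orthopoly j * ([:0, 1:] * orthopoly j))"
    using c_pos unfolding S quadrature_ip_def Q_def sum_distrib_left
    by (intro sum.cong) (auto simp: field_simps)
  also have "\<dots> = M (orthopoly j * ([:0, 1:] * orthopoly j))"
    by (rule quadrature_exact) (use degree_orthopoly[OF j] orthopoly_nonzero[OF j] j in \<open>simp add: degree_mult_eq\<close>)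
  finally show "lanczos_alpha S (Suc j) = M (orthopoly j * ([:0, 1:] * orthopoly j))" .
next
  assume "Suc j < n"
  then show "lanczos_beta S (Suc j) = M (orthopoly (Suc j) * ([:0, 1:] * orthopoly j))"
    using lanczos_orthopoly[OF S, of "Suc j"] by (simp add: lanczos_beta_def del: lanczos.simps)
qed

text \<open>Away from the three diagonals, \<open>x\<close> times the polynomial of lower degree is still of lower degree than
  the other one, and hence orthogonal to it.\<close>

lemma jacobi_mat_eq:
  assumes S: "S = quadrature_ip n c \<theta> y"
  shows "jacobi_mat n (lanczos_alpha S) (lanczos_beta S) =
     mat n n (\<lambda>(i, j). M (orthopoly i * ([:0, 1:] * orthopoly j)))"
proof (rule eq_matI)
  fix i j assume "i < dim_row (mat n n (\<lambda>(i, j). M (orthopoly i * ([:0, 1:] * orthopoly j))))"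
    "j < dim_col (mat n n (\<lambda>(i, j). M (orthopoly i * ([:0, 1:] * orthopoly j))))"
  then have ij: "i < n" "j < n" by auto
  have sym: "M (orthopoly i * ([:0, 1:] * orthopoly j)) = M (orthopoly j * ([:0, 1:] * orthopoly i))" by (simp add: mult_ac)
  have far: "M ([:0, 1:] * orthopoly i * orthopoly k) = 0" if "Suc i < k" "k < n" for i k
  proof (rule orthogonal_to_lower_degree[of orthopoly])
    have "degree ([:0, 1:] * orthopoly i) = Suc i"
      using degree_orthopoly[of i] orthopoly_nonzero[of i] that by (subst degree_mult_eq) auto
    then show "degree ([:0, 1:] * orthopoly i) < k" using that by simp
  qed (use that degree_orthopoly orthopoly_nonzero orthopoly_orthonormal in auto)
  consider "i = j" | "j = Suc i" | "i = Suc j" | "Suc i < j" | "Suc j < i" by linarith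
  then have "(if i = j then lanczos_alpha S (i + 1) else if j = i + 1 then lanczos_beta S (i + 1)
      else if i = j + 1 then lanczos_beta S (j + 1) else 0) = M (orthopoly i * ([:0, 1:] * orthopoly j))"
  proof cases
    case 1 then show ?thesis using jacobi_entries(1)[OF S, of i] ij by simp
  next
    case 2 then show ?thesis using jacobi_entries(2)[OF S, of i] ij sym by simp
  next
    case 3 then show ?thesis using jacobi_entries(2)[OF S, of j] ij by simp
  next
    case 4 then show ?thesis using far[of i j] ij sym by (simp add: mult_ac)
  next
    case 5 then show ?thesis using far[of j i] ij by (simp add: mult_ac)
  qed
  then show "jacobi_mat n (lanczos_alpha S) (lanczos_beta S) $$ (i, j) =
      mat n n (\<lambda>(i, j). M (orthopoly i * ([:0, 1:] * orthopoly j))) $$ (i, j)"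
    using ij by (simp add: jacobi_mat_def)
qed (simp_all add: jacobi_mat_def)

lemma orthopoly_0: "orthopoly 0 = [:1 / sqrt c:]" by (simp add: orthopoly_def pp_0 c)

text \<open>The powers \<open>x\<^sup>k\<close>, the Chebyshev polynomials and the two families of the orthogonalization represent the
  four rows of functions, and each contains one polynomial of each degree.\<close>

lemma krylov_projection:
  assumes b: "\<And>x. x \<in> {0..xm} \<Longrightarrow> b x = eigen_sum bc x"
    and P: "P = cos_sqrt_A v xm lam z \<tau>"
    and u: "u = (\<lambda>k. cos_sqrt_A v xm lam z (real k * \<tau>) b)"
    and S: "S = quadrature_ip n c \<theta> y"
    and Pn: "Pn = jacobi_mat n (lanczos_alpha S) (lanczos_beta S)"
    and bn: "bn = sqrt c \<cdot>\<^sub>v unit_vec n 0"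
    and ubar: "ubar = orth_snapshot v xm b \<tau> lam z"
    and V: "V = normalized_snapshot v xm b \<tau> lam z"
  shows "krylov {0..xm} n (u 0) P = span_on {0..xm} {0..<n} u"
    and "span_on {0..xm} {0..<n} u = span_on {0..xm} {1..n} ubar"
    and "span_on {0..xm} {1..n} V = krylov {0..xm} n (u 0) P"
    and "star_mat v xm n V V = 1\<^sub>m n"
    and "Pn = star_mat v xm n V (\<lambda>j. P (V j))"
    and "bn = star_vec v xm n V b"
    and "bn = (1 / sqrt c) \<cdot>\<^sub>v star_vec v xm n V b \<longleftrightarrow> c = 1"
proof -
  let ?X = "[:0, 1:] :: real poly"
  have u_k: "u k = \<Phi> (cheb_poly k)" for k unfolding u by (rule snapshot_\<Phi>[OF b])
  have P_pow: "(P ^^ k) (u 0) = \<Phi> (?X ^ k)" for k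
  proof (induction k)
    case (Suc k)
    have "P (\<Phi> (?X ^ k)) = \<Phi> (?X * ?X ^ k)" unfolding P by (rule propagator_\<Phi>) simp
    with Suc show ?case by simp
  qed (simp add: u_k)
  have ubar_k: "ubar (Suc k) x = \<Phi> (pp k) x" if "x \<in> {0..xm}" for k x
    using orth_snapshot_eq(1)[OF b that, of "Suc k"] by (simp add: ubar)
  have V_k: "V (Suc k) x = \<Phi> (orthopoly k) x" if "x \<in> {0..xm}" for k x
    using orth_snapshot_eq(2)[OF b that, of "Suc k"] that by (simp add: V orthopoly_def \<Phi>_smult)
  let ?K = "{restrict (\<Phi> p) {0..xm} |p. degree p < n}"
  have K_krylov: "krylov {0..xm} n (u 0) P = ?K"
    unfolding krylov_def
    by (rule span_on_\<Phi>[where g = "\<lambda>k. ?X ^ k"]) (use n in \<open>simp_all add: P_pow degree_power_eq\<close>)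
  have K_u: "span_on {0..xm} {0..<n} u = ?K"
    by (rule span_on_\<Phi>[where g = cheb_poly]) (use n in \<open>simp_all add: u_k degree_cheb_poly\<close>)
  have pp: "degree (pp k) = k" "pp k \<noteq> 0" if "k < n" for k
    using degrees_and_leads[OF that] norm_pp[OF that] by auto
  have K_ubar: "span_on {0..xm} {1..n} ubar = ?K"
    unfolding span_on_reindex
    by (rule span_on_\<Phi>[where g = pp]) (use n in \<open>simp_all add: ubar_k pp\<close>)
  have K_V: "span_on {0..xm} {1..n} V = ?K"
    unfolding span_on_reindex
    by (rule span_on_\<Phi>[where g = orthopoly]) (use n in \<open>simp_all add: V_k degree_orthopoly orthopoly_nonzero\<close>)
  show "krylov {0..xm} n (u 0) P = span_on {0..xm} {0..<n} u"
    and "span_on {0..xm} {0..<n} u = span_on {0..xm} {1..n} ubar"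
    and "span_on {0..xm} {1..n} V = krylov {0..xm} n (u 0) P"
    by (simp_all only: K_krylov K_u K_ubar K_V)
  have ip_V: "ip v xm (V (Suc i)) g = M (orthopoly i * p)" if "\<And>x. x \<in> {0..xm} \<Longrightarrow> g x = \<Phi> p x" for i g p
    unfolding ip_\<Phi>[symmetric] by (rule ip_cong[OF V_k that])
  have PV: "P (V (Suc k)) = \<Phi> (?X * orthopoly k)" for k unfolding P by (rule propagator_\<Phi>[OF V_k])
  have ip_VV: "ip v xm (V (Suc i)) (V (Suc j)) = M (orthopoly i * orthopoly j)" for i j
    by (rule ip_V[OF V_k])
  have ip_VPV: "ip v xm (V (Suc i)) (P (V (Suc j))) = M (orthopoly i * (?X * orthopoly j))" for i j
    by (rule ip_V) (simp only: PV)
  show "star_mat v xm n V V = 1\<^sub>m n"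
    by (rule eq_matI) (auto simp: star_mat_def ip_VV orthopoly_orthonormal)
  show "Pn = star_mat v xm n V (\<lambda>j. P (V j))"
    unfolding Pn jacobi_mat_eq[OF S] star_mat_def
    by (rule eq_matI) (simp_all only: index_mat dim_row_mat dim_col_mat prod.case Suc_eq_plus1[symmetric] ip_VPV)
  have "ip v xm (V (Suc i)) b = sqrt c * (if i = 0 then 1 else 0)" if "i < n" for i
  proof -
    have one: "1 = Polynomial.smult (sqrt c) (orthopoly 0)" using c_pos by (simp add: orthopoly_0 one_pCons)
    have "ip v xm (V (Suc i)) b = M (orthopoly i * 1)"
      by (rule ip_V) (simp add: b \<Phi>_def)
    also have "\<dots> = sqrt c * M (orthopoly i * orthopoly 0)" by (subst one) (simp only: mult_smult_right scale)
    finally show ?thesis using orthopoly_orthonormal[OF that, of 0] n by simp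
  qed
  then show star_b: "bn = star_vec v xm n V b"
    unfolding bn by (intro eq_vecI) (auto simp: star_vec_def)
  show "bn = (1 / sqrt c) \<cdot>\<^sub>v star_vec v xm n V b \<longleftrightarrow> c = 1"
  proof
    assume "bn = (1 / sqrt c) \<cdot>\<^sub>v star_vec v xm n V b"
    then have "bn $ 0 = ((1 / sqrt c) \<cdot>\<^sub>v bn) $ 0" by (simp only: star_b)
    then have "sqrt c = 1" using n c_pos by (simp add: bn)
    then show "c = 1" by simp
  next
    assume "c = 1"
    then show "bn = (1 / sqrt c) \<cdot>\<^sub>v star_vec v xm n V b"
      unfolding star_b[symmetric] by (simp add: bn)
  qed
qed

end

section \<open>The pulse\<close>

lemma A_eigenbasis_imp_eigenfunctions:
  assumes "xm > 0" "continuous_on {0..xm} v" "\<forall>x\<in>{0..xm}. v x > 0" "A_eigenbasis v xm lam z"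
  obtains zd where "eigenfunctions v xm lam z zd"
proof -
  let ?deriv = "\<lambda>l zd. (\<forall>x\<in>{0..xm}. (z l has_real_derivative zd x) (at x within {0..xm})) \<and>
      (\<forall>x\<in>{0..xm}. (zd has_real_derivative - (lam l * z l x) / (v x)\<^sup>2) (at x within {0..xm})) \<and>
      zd 0 = 0 \<and> z l xm = 0"
  have "\<exists>zd. ?deriv l zd" for l
  proof -
    have "A_graph v xm (z l) (\<lambda>x. lam l * z l x)"
      using assms(4) by (simp add: A_eigenbasis_def A_eigenpair_def)
    then obtain u' u'' where u: "\<forall>x\<in>{0..xm}. (z l has_real_derivative u' x) (at x within {0..xm})"
        "\<forall>x\<in>{0..xm}. (u' has_real_derivative u'' x) (at x within {0..xm})"
        "u' 0 = 0" "z l xm = 0" "\<forall>x\<in>{0..xm}. lam l * z l x = - (v x)\<^sup>2 * u'' x"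
      unfolding A_graph_def by blast
    have "u'' x = - (lam l * z l x) / (v x)\<^sup>2" if "x \<in> {0..xm}" for x
    proof -
      have "v x \<noteq> 0" "lam l * z l x = - (v x)\<^sup>2 * u'' x" using u(5) assms(3) that by force+
      then show ?thesis by simp
    qed
    with u(2) have "\<forall>x\<in>{0..xm}. (u' has_real_derivative - (lam l * z l x) / (v x)\<^sup>2) (at x within {0..xm})"
      by simp
    with u(1,3,4) show ?thesis by blast
  qed
  then have "\<forall>l. \<exists>zd. ?deriv l zd" by blast
  from choice[OF this] obtain zd where zd: "\<forall>l. ?deriv l (zd l)" by blast
  have "eigenfunctions v xm lam z zd"
  proof
    show "0 < xm" "continuous_on {0..xm} v" by fact+
    show "0 < v x" if "x \<in> {0..xm}" for x using assms(3) that by blast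
    show "ip v xm (z l) (z k) = (if l = k then 1 else 0)" for l k
      using assms(4) by (simp add: A_eigenbasis_def)
  qed (use zd in blast)+
  then show ?thesis by (rule that)
qed

text \<open>The order \<open>16\<close> of the pulse gives \<open>qtilde q (lam l) = O (lam l ^ -8)\<close>, hence its square root is
  \<open>O (lam l ^ -4)\<close>. With \<open>z l 0 = O (lam l)\<close> and the weight \<open>(lam l)\<^sup>2\<close>, the terms are
  \<open>O (1 / lam l)\<close>, which is summable.\<close>

lemma (in eigenfunctions) pulse_coefficients_rapid:
  assumes "smooth_L1 pulse_order q" "\<And>t. q (- t) = q t" "\<forall>s. qtilde q (s\<^sup>2) \<ge> 0"
  shows "tame (\<lambda>l. lam l * (sqrt (qtilde q (lam l)) * z l 0 / v 0))"
proof -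
  obtain C where C: "C \<ge> 0" "\<And>s. s \<ge> 0 \<Longrightarrow> s ^ 8 * \<bar>qtilde q s\<bar> \<le> C"
    using qtilde_decay[of 8 q] assms(1,2) by (auto simp: pulse_order_def)
  obtain K where K: "K \<ge> 0" "\<And>l x. x \<in> {0..xm} \<Longrightarrow> \<bar>z l x\<bar> \<le> K * lam l"
    "\<And>l x. x \<in> {0..xm} \<Longrightarrow> \<bar>zd l x\<bar> \<le> K * lam l"
    by (rule eigenfunction_bounds) (rule that)
  have v0: "v 0 > 0" using v_pos[of 0] xm by simp
  show ?thesis unfolding tame_def
  proof (rule summable_comparison_test'[of "\<lambda>l. sqrt C * K / v 0 * (1 / lam l)" 0])
    show "summable (\<lambda>l. sqrt C * K / v 0 * (1 / lam l))"
      by (rule summable_mult[OF summable_inverse_lam])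
    fix l :: nat
    have lam: "lam l > 0" by (rule lam_pos)
    have "qtilde q ((sqrt (lam l))\<^sup>2) \<ge> 0" using assms(3) by blast
    then have qt: "qtilde q (lam l) \<ge> 0" using lam by simp
    have "sqrt (lam l ^ 8 * qtilde q (lam l)) \<le> sqrt C"
      using C(2)[of "lam l"] lam qt by (intro real_sqrt_le_mono) simp
    moreover have "sqrt (lam l ^ 8) = lam l ^ 4"
      using real_sqrt_unique[of "lam l ^ 4" "lam l ^ 8"] lam by (simp flip: power_mult)
    ultimately have "lam l ^ 4 * sqrt (qtilde q (lam l)) \<le> sqrt C" by (simp add: real_sqrt_mult)
    moreover have "\<bar>z l 0\<bar> \<le> K * lam l" using K(2)[of 0 l] xm by simp
    ultimately have "(lam l ^ 4 * sqrt (qtilde q (lam l))) * \<bar>z l 0\<bar> \<le> sqrt C * (K * lam l)"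
      using C(1) lam qt by (intro mult_mono) auto
    then have "lam l ^ 2 * (sqrt (qtilde q (lam l)) * \<bar>z l 0\<bar>) \<le> sqrt C * K / lam l"
      using lam by (simp add: field_simps eval_nat_numeral)
    then have "lam l ^ 2 * (sqrt (qtilde q (lam l)) * \<bar>z l 0\<bar>) / v 0 \<le> sqrt C * K / lam l / v 0"
      using v0 by (intro divide_right_mono) auto
    then show "norm (\<bar>lam l * (sqrt (qtilde q (lam l)) * z l 0 / v 0)\<bar> * lam l)
        \<le> sqrt C * K / v 0 * (1 / lam l)"
      using lam qt v0 by (simp add: abs_mult power2_eq_square mult_ac)
  qed
qed

lemma (in eigenfunctions) pulse_b_expansion:
  assumes "tame (\<lambda>l. sqrt (qtilde q (lam l)) * z l 0 / v 0)" "x \<in> {0..xm}"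
  shows "pulse_b v q lam z x = eigen_sum (\<lambda>l. sqrt (qtilde q (lam l)) * z l 0 / v 0) x"
proof -
  have v0: "v 0 > 0" using v_pos[of 0] xm by simp
  note s = summable_mult[OF summable_expansion(1)[OF assms], of "1 / v 0"]
  have eq: "sqrt (qtilde q (lam l)) * delta0 v (z l) * z l x =
      1 / v 0 * (sqrt (qtilde q (lam l)) * z l 0 / v 0 * z l x)" for l
    by (simp add: delta0_def power2_eq_square)
  show ?thesis
    unfolding pulse_b_def spectral_apply_def eq suminf_mult[OF summable_expansion(1)[OF assms]]
    using v0 by (simp add: eigen_sum_def)
qed

theorem lemma4p5:
  fixes v q :: "real \<Rightarrow> real" and xm \<tau> c :: real and n :: nat
    and lam :: "nat \<Rightarrow> real" and z u ubar V :: "nat \<Rightarrow> real \<Rightarrow> real"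
    and b :: "real \<Rightarrow> real" and P :: "(real \<Rightarrow> real) \<Rightarrow> real \<Rightarrow> real"
    and f \<theta> y :: "nat \<Rightarrow> real" and S :: "real poly \<Rightarrow> real poly \<Rightarrow> real"
    and Pn :: "real mat" and bn :: "real vec"
  assumes "xm > 0" and "continuous_on {0..xm} v" and "\<forall>x\<in>{0..xm}. v x > 0"
    and "A_eigenbasis v xm lam z"
    and "smooth_L1 pulse_order q" and "\<forall>t. q (- t) = q t"
    and "\<forall>s. qtilde q (s\<^sup>2) \<ge> 0"
    and "\<forall>g. L2_on xm g \<and> ip v xm g g > 0 \<longrightarrow> ip v xm g (qtilde_A v xm q lam z g) > 0"
    and "\<tau> > 0" and "n \<ge> 1"
    and b_def: "b = pulse_b v q lam z"
    and P_def: "P = cos_sqrt_A v xm lam z \<tau>"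
    and u_def: "u = (\<lambda>k. cos_sqrt_A v xm lam z (real k * \<tau>) b)"
    and f_def: "f = (\<lambda>k. ip v xm (u 0) (u k))"
    and c_def: "c = f 0"
    and "prob_space (scale_measure (ennreal (1 / c)) (eta0 v q \<tau> lam z))"
    and "has_n_points_of_increase n (scale_measure (ennreal (1 / c)) (eta0 v q \<tau> lam z))"
    and "quadrature_data n f \<theta> y"
    and S_def: "S = quadrature_ip n c \<theta> y"
    and Pn_def: "Pn = jacobi_mat n (lanczos_alpha S) (lanczos_beta S)"
    and bn_def: "bn = sqrt c \<cdot>\<^sub>v unit_vec n 0"
    and ubar_def: "ubar = orth_snapshot v xm b \<tau> lam z"
    and V_def: "V = normalized_snapshot v xm b \<tau> lam z"
  shows "krylov {0..xm} n (u 0) P = span_on {0..xm} {0..<n} u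
    \<and> span_on {0..xm} {0..<n} u = span_on {0..xm} {1..n} ubar
    \<and> span_on {0..xm} {1..n} V = krylov {0..xm} n (u 0) P \<and> star_mat v xm n V V = 1\<^sub>m n
    \<and> Pn = star_mat v xm n V (\<lambda>j. P (V j))
    \<and> bn = star_vec v xm n V b
    \<and> (bn = (1 / sqrt c) \<cdot>\<^sub>v star_vec v xm n V b \<longleftrightarrow> c = 1)"
proof -
  obtain zd where "eigenfunctions v xm lam z zd"
    using A_eigenbasis_imp_eigenfunctions[OF assms(1-4)] by blast
  then interpret eigenfunctions v xm lam z zd .
  define bc where "bc l = sqrt (qtilde q (lam l)) * z l 0 / v 0" for l
  have rapid: "tame (\<lambda>l. lam l * bc l)"
    unfolding bc_def by (rule pulse_coefficients_rapid) (use assms(5-7) in auto)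
  interpret snapshots v xm lam z zd \<tau> bc
    by unfold_locales (use \<open>\<tau> > 0\<close> rapid in auto)
  have b: "b x = eigen_sum bc x" if "x \<in> {0..xm}" for x
    unfolding b_def bc_def[abs_def]
    by (rule pulse_b_expansion[OF tame_bc[unfolded bc_def[abs_def]] that])
  have u: "u k = \<Phi> (cheb_poly k)" for k
    unfolding u_def by (rule snapshot_\<Phi>[OF b])
  have f: "f k = M (cheb_poly k)" for k
    using ip_\<Phi>[of 1 "cheb_poly k"] by (simp add: f_def u)
  have quad: "quadrature_data n f \<theta> y" by fact
  interpret snapshot_quadrature v xm lam z zd \<tau> bc n \<theta> y c
    by unfold_locales
      (use quad \<open>n \<ge> 1\<close> in \<open>auto simp: quadrature_data_def c_def f\<close>)
  show ?thesis
    using krylov_projection[OF b P_def u_def S_def Pn_def bn_def ubar_def V_def] by blast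
qed

end
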